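(* Define groups $K_0=\mathbb Z/2\mathbb Z$ and $K_{k+1}=K_k\wr_X\Gamma$ for $k\ge0$, where $\Gamma$ is the first Grigorchuk group and $X=\rho\Gamma$. Then every $K_k$ is a finitely generated torsion group, infinite for $k\ge1$, with growth function $v_{K_k}(n)\sim\exp\big(n^{1-(1-\alpha)^k}\big)$.
   Context: The first Grigorchuk group $\Gamma$ is the group of permutations of $\{0,1\}^{\mathbb N}$ (acting on the right) generated by $a,b,c,d$, defined recursively for $x\in\{0,1\}$ and infinite binary sequences $u$ by: $(xu)a=(1-x)u$; $(0u)b=0(ua)$, $(1u)b=1(uc)$; $(0u)c=0(ua)$, $(1u)c=1(ud)$; $(0u)d=0u$, $(1u)d=1(ub)$. Let $\rho=111\cdots$ and $X=\rho\Gamma$ its orbit. Let $\eta$ be the real root of $t^3+t^2+t-2$ and $\alpha=\log2/\log(2/\eta)$. For groups $A,G$ with $G$ acting on the right on $X$, $A\wr_XG=(\bigoplus_XA)\rtimes G$, where $\bigoplus_XA$ is the group of finitely supported functions $X\to A$ and $(g\cdot f)(x)=f(xg)$. Growth functions are counted with respect to finite generating sets; $g\preceq f$ if $g(n)\le f(Cn)$ for some $C>0$ and all large $n$, and $f\sim g$ if $f\preceq g\preceq f$.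
   Formalization: The growth estimate is stated only for k ≥ 1: for k = 0 the group has two elements, so v(n) = 2 for n ≥ 1, while exp(n^0) = e > 2, and exp(n^0) ⪯ v fails under the stated definition; all other claims are kept for every k. *)

theory Defs
  imports Complex_Main "HOL-Algebra.Algebra"
begin

text \<open>Infinite binary sequences; the letter 1 is True, 0 is False.\<close>
type_synonym seq = "nat \<Rightarrow> bool"

datatype ggen = GA | GB | GC | GD

text \<open>The recursive definition of a,b,c,d, evaluated on finite prefixes
  (it determines the action on infinite sequences letter by letter).\<close>
fun gact_list :: "ggen \<Rightarrow> bool list \<Rightarrow> bool list" where
  "gact_list g [] = []"
| "gact_list GA (x # u) = (\<not> x) # u"
| "gact_list GB (False # u) = False # gact_list GA u"
| "gact_list GB (True # u) = True # gact_list GC u"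
| "gact_list GC (False # u) = False # gact_list GA u"
| "gact_list GC (True # u) = True # gact_list GD u"
| "gact_list GD (False # u) = False # u"
| "gact_list GD (True # u) = True # gact_list GB u"

definition gact :: "ggen \<Rightarrow> seq \<Rightarrow> seq" where
  "gact s x = (\<lambda>i. gact_list s (map x [0..<Suc i]) ! i)"

text \<open>The group generated by a,b,c,d inside the permutations of the sequence space.
  Elements are maps \<open>g\<close> with \<open>x g = g x\<close>; since the action is on the right,
  the product \<open>g h\<close> is the map \<open>h \<circ> g\<close>.\<close>
definition Grig :: "(seq \<Rightarrow> seq) monoid" where
  "Grig = \<lparr>carrier = generate (BijGroup (UNIV :: seq set)) (range gact),
           monoid.mult = (\<lambda>g h. h \<circ> g), one = id\<rparr>"

definition rho :: seq where "rho = (\<lambda>_. True)"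

definition Xorb :: "seq set" where
  "Xorb = (\<lambda>g. g rho) ` carrier Grig"

text \<open>Elements are pairs (f, g) with f a finitely supported function X \<rightarrow> A (extended by
  the identity outside X) and g in \<Gamma>; \<Gamma> acts by \<open>(g\<cdot>f)(x) = f(xg)\<close> and the
  product is \<open>(f,g)(f',g') = (f\<cdot>(g\<cdot>f'), gg')\<close>.\<close>
definition wreath :: "('a, 'm) monoid_scheme \<Rightarrow> ((seq \<Rightarrow> 'a) \<times> (seq \<Rightarrow> seq)) monoid" where
  "wreath A = \<lparr>carrier = {(f, g). g \<in> carrier Grig \<and> (\<forall>x\<in>Xorb. f x \<in> carrier A)
                  \<and> (\<forall>x. x \<notin> Xorb \<longrightarrow> f x = \<one>\<^bsub>A\<^esub>) \<and> finite {x. f x \<noteq> \<one>\<^bsub>A\<^esub>}},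
     monoid.mult = (\<lambda>(f, g) (f', g').
        ((\<lambda>x. if x \<in> Xorb then f x \<otimes>\<^bsub>A\<^esub> f' (g x) else \<one>\<^bsub>A\<^esub>), g \<otimes>\<^bsub>Grig\<^esub> g')),
     one = ((\<lambda>_. \<one>\<^bsub>A\<^esub>), \<one>\<^bsub>Grig\<^esub>)\<rparr>"

section \<open>The groups K_k, realised in one universe type\<close>

datatype kel = KZ (kz: int) | KW (kf: "seq \<Rightarrow> kel") (kg: "seq \<Rightarrow> seq")

definition transport :: "('a \<Rightarrow> 'b) \<Rightarrow> ('b \<Rightarrow> 'a) \<Rightarrow> 'a monoid \<Rightarrow> 'b monoid" where
  "transport h h' G = \<lparr>carrier = h ` carrier G,
     monoid.mult = (\<lambda>x y. h (h' x \<otimes>\<^bsub>G\<^esub> h' y)), one = h \<one>\<^bsub>G\<^esub>\<rparr>"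

fun Kgrp :: "nat \<Rightarrow> kel monoid" where
  "Kgrp 0 = transport KZ kz (integer_mod_group 2)"
| "Kgrp (Suc k) = transport (\<lambda>(f, g). KW f g) (\<lambda>x. (kf x, kg x)) (wreath (Kgrp k))"

definition fin_gen :: "('a, 'm) monoid_scheme \<Rightarrow> bool" where
  "fin_gen G \<longleftrightarrow> (\<exists>S. finite S \<and> S \<subseteq> carrier G \<and> generate G S = carrier G)"

definition torsion_group :: "('a, 'm) monoid_scheme \<Rightarrow> bool" where
  "torsion_group G \<longleftrightarrow> (\<forall>x\<in>carrier G. \<exists>n::nat. n > 0 \<and> x [^]\<^bsub>G\<^esub> n = \<one>\<^bsub>G\<^esub>)"

definition word_eval :: "('a, 'm) monoid_scheme \<Rightarrow> 'a list \<Rightarrow> 'a" where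
  "word_eval G xs = foldr (\<lambda>x y. x \<otimes>\<^bsub>G\<^esub> y) xs \<one>\<^bsub>G\<^esub>"

definition growth :: "('a, 'm) monoid_scheme \<Rightarrow> 'a set \<Rightarrow> nat \<Rightarrow> real" where
  "growth G S n = real (card {word_eval G xs | xs.
      set xs \<subseteq> S \<union> (\<lambda>s. inv\<^bsub>G\<^esub> s) ` S \<and> length xs \<le> n})"

definition gpreceq :: "(nat \<Rightarrow> real) \<Rightarrow> (nat \<Rightarrow> real) \<Rightarrow> bool" where
  "gpreceq g f \<longleftrightarrow> (\<exists>C::nat. C > 0 \<and> (\<forall>\<^sub>F n in sequentially. g n \<le> f (C * n)))"

definition gequiv :: "(nat \<Rightarrow> real) \<Rightarrow> (nat \<Rightarrow> real) \<Rightarrow> bool" where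
  "gequiv f g \<longleftrightarrow> gpreceq f g \<and> gpreceq g f"

definition eta :: real where
  "eta = (THE t::real. t ^ 3 + t ^ 2 + t - 2 = 0)"

definition alpha :: real where
  "alpha = ln 2 / ln (2 / eta)"

end

theory Submission
  imports Defs
begin

text \<open>A word over the generators of \<open>A\<close> (acting at \<open>\<rho>\<close>) and \<open>a, b, c, d\<close> decomposes, by the
  recursion defining the action, into one word for each first letter 0, 1. Weighting
  \<open>a, b, c, d\<close> by \<open>1 - \<eta>\<^sup>3, \<eta>\<^sup>3, 1 - \<eta>\<^sup>2, 1 - \<eta>\<close>, the total weight shrinks by the factor \<open>\<eta>\<close>.
  This gives torsion by induction on the weight. Iterating \<open>k\<close> times with
  \<open>(2/\<eta>)\<^sup>k \<approx> n\<close>, an element of length \<open>n\<close> is determined by \<open>2\<^sup>k \<approx> n\<^sup>\<alpha>\<close> signs and by words of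
  total weight \<open>O(2\<^sup>k)\<close> whose letters from \<open>A\<close> have total length at most \<open>n\<close>; counting these gives
  the upper bound. For the lower bound, a substitution inverting the recursion produces words of
  length \<open>O((2/\<eta>)\<^sup>k)\<close> visiting \<open>2\<^sup>k\<close> points of the orbit, at each of which an arbitrary element of
  length \<open>\<eta>\<^sup>-\<^sup>k\<close> of \<open>A\<close> can be placed. Both bounds turn the exponent \<open>\<beta>\<close> into
  \<open>\<alpha> + (1 - \<alpha>) \<beta>\<close>.\<close>

subsection \<open>The action on sequences\<close>

text \<open>The weights come from requiring that every pair \<open>a v\<close> with
  \<open>v = b, c, d\<close> shrink by exactly \<open>eta\<close>; the pairs then weigh 1,
  \<open>eta\<close>, \<open>eta^2\<close>. The same three numbers form an eigenvector of the
  substitution behind the lower bound, which is why the two bounds meet.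

  A letter before the first \<open>a\<close> belongs to no pair and is not contracted. For torsion
  it is moved to the end by conjugation; in the count it costs at most \<open>na\<close> at each
  vertex of a binary tree of depth \<open>k\<close>, hence \<open>O(2^k)\<close> in all.

  The obstacle in the upper bound is that the letters from \<open>A\<close> may share the length
  \<open>n\<close> unevenly among \<open>O(2^k)\<close> places. The induction therefore carries a
  bound on sums of \<open>exp (- r * len s)\<close> over the balls of \<open>A\<close>, with
  \<open>r\<close> tuned to the average length \<open>L = eta^-k\<close>; such sums multiply over
  the letters of a word. Passing from ball sizes to these sums costs a factor of order
  \<open>L^(1-b)\<close>, which \<open>exp (C * L^b)\<close> absorbs only for \<open>b > 0\<close>;
  the finite group \<open>Kgrp 0\<close>, with exponent 0, gets its sum bound directly.\<close>

definition scons :: "bool \<Rightarrow> seq \<Rightarrow> seq" where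
  "scons b u = case_nat b u"

lemma scons_0 [simp]: "scons b u 0 = b"
  and scons_Suc [simp]: "scons b u (Suc i) = u i"
  by (simp_all add: scons_def)

lemma scons_eq_iff [simp]: "scons b u = scons c v \<longleftrightarrow> b = c \<and> u = v"
proof
  assume "scons b u = scons c v"
  then have eq: "scons b u i = scons c v i" for i
    by simp
  show "b = c \<and> u = v"
    using eq[of 0] eq[of "Suc i" for i] by auto
qed simp

lemma scons_exhaust: obtains b u where "x = scons b u"
proof
  show "x = scons (x 0) (\<lambda>i. x (Suc i))"
    by (rule ext) (simp add: scons_def split: nat.split)
qed

lemma rho_scons: "rho = scons True rho"
  by (rule ext) (simp add: rho_def scons_def split: nat.split)

lemma scons_eq_rho_iff [simp]: "scons b u = rho \<longleftrightarrow> b \<and> u = rho"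
  by (metis (full_types) rho_scons scons_eq_iff)

lemma map_scons_upt: "map (scons b u) [0..<Suc i] = b # map u [0..<i]"
  by (simp add: map_upt_Suc del: upt_Suc)

text \<open>Stripping the first letter of a prefix turns position \<open>Suc j\<close> into position
  \<open>j\<close> of the tail, so the prefix-wise \<open>gact\<close> satisfies the recursion on
  infinite sequences.\<close>

lemma gact_scons [simp]:
  "gact GA (scons b u) = scons (\<not> b) u"
  "gact GB (scons b u) = scons b (if b then gact GC u else gact GA u)"
  "gact GC (scons b u) = scons b (if b then gact GD u else gact GA u)"
  "gact GD (scons b u) = scons b (if b then gact GB u else u)"
proof -
  have eqI: "gact s (scons b u) = scons c v"
    if "gact_list s [b] = [c]"
      "\<And>j. gact_list s (b # map u [0..<Suc j]) ! Suc j = v j" for s c v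
  proof
    fix i
    show "gact s (scons b u) i = scons c v i"
      using that unfolding gact_def map_scons_upt by (cases i) (auto simp del: upt_Suc)
  qed
  have nth: "map u [0..<Suc j] ! j = u j" for j
    by (simp del: upt_Suc)
  show "gact GA (scons b u) = scons (\<not> b) u"
    "gact GB (scons b u) = scons b (if b then gact GC u else gact GA u)"
    "gact GC (scons b u) = scons b (if b then gact GD u else gact GA u)"
    "gact GD (scons b u) = scons b (if b then gact GB u else u)"
    by (rule eqI; cases b; simp add: gact_def nth del: upt_Suc)+
qed

section \<open>The Klein four-group formed by 1, b, c, d\<close>

datatype v4 = VE | VB | VC | VD

instance v4 :: finite
proof
  have "(UNIV :: v4 set) = {VE, VB, VC, VD}"
    using v4.exhaust by auto
  then show "finite (UNIV :: v4 set)"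
    by (metis finite.emptyI finite_insert)
qed

lemma card_v4: "card (UNIV :: v4 set) = 4"
proof -
  have "(UNIV :: v4 set) = {VE, VB, VC, VD}"
    using v4.exhaust by auto
  moreover have "card {VE, VB, VC, VD} = 4"
    by simp
  ultimately show ?thesis
    by metis
qed

fun vmul :: "v4 \<Rightarrow> v4 \<Rightarrow> v4" where
  "vmul VE w = w"
| "vmul v VE = v"
| "vmul VB VC = VD" | "vmul VC VB = VD"
| "vmul VB VD = VC" | "vmul VD VB = VC"
| "vmul VC VD = VB" | "vmul VD VC = VB"
| "vmul VB VB = VE" | "vmul VC VC = VE" | "vmul VD VD = VE"

fun vact :: "v4 \<Rightarrow> seq \<Rightarrow> seq" where
  "vact VE x = x"
| "vact VB x = gact GB x"
| "vact VC x = gact GC x"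
| "vact VD x = gact GD x"

text \<open>The two coordinates of the wreath recursion b = (a, c), c = (a, d), d = (1, b).\<close>
fun vom :: "v4 \<Rightarrow> bool" where
  "vom VE = False" | "vom VB = True" | "vom VC = True" | "vom VD = False"

fun vph :: "v4 \<Rightarrow> v4" where
  "vph VE = VE" | "vph VB = VC" | "vph VC = VD" | "vph VD = VB"

lemma vmul_self [simp]: "vmul v v = VE"
  by (cases v) auto

lemma vmul_VE [simp]: "vmul v VE = v"
  by (cases v) auto

lemma vact_scons [simp]:
  "vact v (scons b u) = scons b (if b then vact (vph v) u else if vom v then gact GA u else u)"
  by (cases v) auto

lemma gact_GA_GA [simp]: "gact GA (gact GA x) = x"
  by (rule scons_exhaust[of x]) simp

lemma vom_vmul: "vom (vmul v w) = (vom v \<noteq> vom w)"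
  by (cases v; cases w) auto

lemma vph_vmul: "vph (vmul v w) = vmul (vph v) (vph w)"
  by (cases v; cases w) auto

text \<open>Both \<open>vom\<close> and \<open>vph\<close> are homomorphisms on the four-group, so
  letter \<open>Suc i\<close> of the two sides reduces to letter \<open>i\<close> for the sections;
  at 0 the sections are powers of the involution \<open>a\<close>.\<close>

lemma vact_vact [simp]: "vact v (vact w x) = vact (vmul v w) x"
proof
  fix i
  show "vact v (vact w x) i = vact (vmul v w) x i"
  proof (induction i arbitrary: v w x)
    case 0
    show ?case
      by (rule scons_exhaust[of x]) simp
  next
    case (Suc i)
    then show ?case
      by (rule_tac scons_exhaust[of x]) (simp add: vom_vmul vph_vmul)
  qed
qed

text \<open>The sequence 111... only ever meets the section at 1, and that section is again in the
  four-group.\<close>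

lemma vact_rho [simp]: "vact v rho = rho"
proof
  fix i
  show "vact v rho i = rho i"
  proof (induction i arbitrary: v)
    case 0
    then show ?case
      by (subst rho_scons) (simp add: rho_def)
  next
    case (Suc i)
    then show ?case
      by (subst rho_scons) (simp add: rho_def)
  qed
qed

lemma vact_eq_rho_iff [simp]: "vact v x = rho \<longleftrightarrow> x = rho"
  by (metis vact.simps(1) vact_rho vact_vact vmul_self)

fun gen_v4 :: "ggen \<Rightarrow> v4" where
  "gen_v4 GA = VE" | "gen_v4 GB = VB" | "gen_v4 GC = VC" | "gen_v4 GD = VD"

lemma gact_vact: "s \<noteq> GA \<Longrightarrow> gact s x = vact (gen_v4 s) x"
  by (cases s) auto

lemma gact_gact [simp]: "gact s (gact s x) = x"
  by (cases "s = GA") (simp_all add: gact_vact)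

lemma bij_gact: "bij (gact s)"
  by (metis bij_betw_def gact_gact inj_on_inverseI surjI)

lemma inj_gact: "inj (gact s)"
  by (rule bij_is_inj[OF bij_gact])

subsection \<open>The group and its orbit\<close>

definition wact :: "ggen list \<Rightarrow> seq \<Rightarrow> seq" where
  "wact w x = fold gact w x"

lemma wact_Nil [simp]: "wact [] x = x"
  and wact_Cons [simp]: "wact (s # w) x = wact w (gact s x)"
  and wact_append [simp]: "wact (u @ w) x = wact w (wact u x)"
  by (simp_all add: wact_def)

lemma wact_rev_wact [simp]: "wact (rev w) (wact w x) = x"
  by (induction w arbitrary: x) auto

lemma wact_wact_rev [simp]: "wact w (wact (rev w) x) = x"
  by (metis rev_rev_ident wact_rev_wact)

lemma inj_wact: "inj (wact w)"
  by (metis inj_on_inverseI wact_rev_wact)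

text \<open>The generators are involutions, so inverses add no new words. The product of
  \<open>BijGroup\<close> is ordinary composition while \<open>wact\<close> reads words from left to
  right; this reverses concatenation but leaves the set unchanged.\<close>

lemma carrier_Grig: "carrier Grig = range wact"
proof -
  let ?B = "BijGroup (UNIV :: seq set)"
  interpret B: group ?B
    by (rule group_BijGroup)
  have carrier_B: "carrier ?B = {f. bij f}"
    by (auto simp: BijGroup_def Bij_def)
  have mult_B: "g \<otimes>\<^bsub>?B\<^esub> f = g \<circ> f" if "bij g" "bij f" for f g
    using that by (simp add: BijGroup_def Bij_def compose_def o_def restrict_def)
  have one_B: "\<one>\<^bsub>?B\<^esub> = wact []"
    by (auto simp: BijGroup_def)
  have bij_wact: "bij (wact w)" for w
    by (metis inj_wact bij_def surjI wact_wact_rev)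
  have inv_gact: "inv\<^bsub>?B\<^esub> (gact s) = gact s" for s
  proof (rule B.inv_equality)
    show "gact s \<otimes>\<^bsub>?B\<^esub> gact s = \<one>\<^bsub>?B\<^esub>"
      by (simp add: mult_B bij_gact one_B fun_eq_iff)
  qed (simp_all add: carrier_B bij_gact)
  have gact_wact: "gact s = wact [s]" for s
    by (simp add: fun_eq_iff)
  have wact_comp: "wact u \<circ> wact v = wact (v @ u)" for u v
    by (simp add: fun_eq_iff)
  have "generate ?B (range gact) = range wact"
  proof (intro equalityI subsetI)
    fix g assume "g \<in> generate ?B (range gact)"
    then show "g \<in> range wact"
    proof induction
      case (eng h1 h2)
      then obtain u v where "h1 = wact u" "h2 = wact v"
        by blast
      then have "h1 \<otimes>\<^bsub>?B\<^esub> h2 = wact (v @ u)"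
        by (simp only: mult_B bij_wact wact_comp)
      then show ?case
        by (metis rangeI)
    next
      case one
      show ?case
        unfolding one_B by (rule rangeI)
    next
      case (incl h)
      then obtain s where "h = gact s"
        by blast
      then show ?case
        using gact_wact[of s] range_eqI by metis
    next
      case (inv h)
      then obtain s where "h = gact s"
        by blast
      then have "inv\<^bsub>?B\<^esub> h = wact [s]"
        using inv_gact[of s] gact_wact[of s] by metis
      then show ?case
        by (rule range_eqI)
    qed
  next
    fix g assume "g \<in> range wact"
    then obtain w where "g = wact w" by auto
    moreover have "wact w \<in> generate ?B (range gact)"
    proof (induction w)
      case Nil
      show ?case
        using generate.one[of ?B "range gact"] by (simp only: one_B)
    next
      case (Cons s w)
      have "wact (s # w) = wact w \<otimes>\<^bsub>?B\<^esub> gact s"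
        unfolding mult_B[OF bij_wact bij_gact] by (simp add: fun_eq_iff)
      moreover have "wact w \<otimes>\<^bsub>?B\<^esub> gact s \<in> generate ?B (range gact)"
        by (intro generate.eng Cons generate.incl rangeI)
      ultimately show ?case
        by (simp only:)
    qed
    ultimately show "g \<in> generate ?B (range gact)" by simp
  qed
  then show ?thesis
    by (simp add: Grig_def)
qed

lemma wact_in_Grig [simp]: "wact w \<in> carrier Grig"
  by (simp add: carrier_Grig)

lemma mult_Grig [simp]: "g \<otimes>\<^bsub>Grig\<^esub> h = h \<circ> g"
  and one_Grig [simp]: "\<one>\<^bsub>Grig\<^esub> = id"
  by (simp_all add: Grig_def)

lemma Xorb_iff: "x \<in> Xorb \<longleftrightarrow> (\<exists>w. x = wact w rho)"
  by (auto simp: Xorb_def carrier_Grig)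

lemma rho_in_Xorb [simp]: "rho \<in> Xorb"
  by (metis Xorb_iff wact_Nil)

lemma wact_in_Xorb_iff [simp]: "wact w x \<in> Xorb \<longleftrightarrow> x \<in> Xorb"
  by (metis Xorb_iff wact_append wact_rev_wact)

lemma Grig_cases:
  assumes "g \<in> carrier Grig"
  obtains w where "g = wact w"
  using assms by (auto simp: carrier_Grig)

subsection \<open>Words over the generators of the wreath product\<close>

text \<open>The letter \<open>TV v s\<close> stands for an element of the Klein four-group \<open>{1, b, c, d}\<close>
  together with an element \<open>s\<close> of \<open>A\<close> placed at \<open>\<rho>\<close>; these two
  commute since \<open>b\<close>, \<open>c\<close>, \<open>d\<close> fix \<open>\<rho>\<close>.\<close>
datatype 'a tok = TA | TV v4 'a

fun tact :: "'a tok \<Rightarrow> seq \<Rightarrow> seq" where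
  "tact TA x = gact GA x"
| "tact (TV v s) x = vact v x"

definition tac :: "'a tok list \<Rightarrow> seq \<Rightarrow> seq" where
  "tac w x = fold tact w x"

lemma tac_Nil [simp]: "tac [] x = x"
  and tac_Cons [simp]: "tac (t # w) x = tac w (tact t x)"
  and tac_append [simp]: "tac (u @ w) x = tac w (tac u x)"
  by (simp_all add: tac_def)

text \<open>The word induced on the tail of a sequence that starts with \<open>b\<close>. A letter
  of \<open>A\<close> sits at \<rho> = 1\<rho>, so it survives only when it is read in state
  1.\<close>

fun sec :: "bool \<Rightarrow> 'a tok list \<Rightarrow> 'a tok list" where
  "sec b [] = []"
| "sec b (TA # w) = sec (\<not> b) w"
| "sec True (TV v s # w) = TV (vph v) s # sec True w"
| "sec False (TV v s # w) = (if vom v then TA # sec False w else sec False w)"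

fun par :: "bool \<Rightarrow> 'a tok list \<Rightarrow> bool" where
  "par b [] = b"
| "par b (TA # w) = par (\<not> b) w"
| "par b (TV v s # w) = par b w"

lemma tac_scons: "tac w (scons b u) = scons (par b w) (tac (sec b w) u)"
  by (induction b w arbitrary: u rule: sec.induct) auto

lemma par_append: "par b (u @ w) = par (par b u) w"
  by (induction b u rule: par.induct) auto

lemma sec_append: "sec b (u @ w) = sec b u @ sec (par b u) w"
  by (induction b u rule: sec.induct) auto

lemma par_neg: "par (\<not> b) w = (\<not> par b w)"
  by (induction b w rule: par.induct) auto

fun tok_ggens :: "'a tok \<Rightarrow> ggen list" where
  "tok_ggens TA = [GA]"
| "tok_ggens (TV VE s) = []"
| "tok_ggens (TV VB s) = [GB]"
| "tok_ggens (TV VC s) = [GC]"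
| "tok_ggens (TV VD s) = [GD]"

lemma tact_wact: "tact t x = wact (tok_ggens t) x"
  by (cases t rule: tok_ggens.cases) auto

lemma tac_wact: "tac w x = wact (concat (map tok_ggens w)) x"
  by (induction w arbitrary: x) (auto simp: tact_wact)

lemma tac_in_Grig: "tac w \<in> carrier Grig"
  using wact_in_Grig[of "concat (map tok_ggens w)"] tac_wact[of w]
  by (metis ext)

lemma tac_in_Xorb_iff [simp]: "tac w x \<in> Xorb \<longleftrightarrow> x \<in> Xorb"
  by (simp add: tac_wact)

lemma tact_in_Xorb_iff [simp]: "tact t x \<in> Xorb \<longleftrightarrow> x \<in> Xorb"
  by (simp add: tact_wact)

lemma inj_tact: "inj (tact t)"
  using inj_wact[of "tok_ggens t"] tact_wact[of t] by (metis ext)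

locale wreath_base = group A for A (structure)
begin

definition "W = wreath A"

definition toks :: "'a tok set" where
  "toks = insert TA {TV v s | v s. s \<in> carrier A}"

lemma TA_toks [simp]: "TA \<in> toks"
  and TV_toks [simp]: "TV v s \<in> toks \<longleftrightarrow> s \<in> carrier A"
  by (auto simp: toks_def)

fun twt :: "'a tok \<Rightarrow> seq \<Rightarrow> 'a" where
  "twt TA x = \<one>"
| "twt (TV v s) x = (if x = rho then s else \<one>)"

text \<open>The coordinate at \<open>x\<close> of the element represented by the word: follow
  \<open>x\<close> along the word and multiply up the letters of \<open>A\<close> met while the
  point is at \<rho>.\<close>

fun wt :: "'a tok list \<Rightarrow> seq \<Rightarrow> 'a" where
  "wt [] x = \<one>"
| "wt (t # w) x = twt t x \<otimes> wt w (tact t x)"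

lemma twt_closed [simp]: "t \<in> toks \<Longrightarrow> twt t x \<in> carrier A"
  by (cases t) auto

lemma wt_closed [simp]: "w \<in> lists toks \<Longrightarrow> wt w x \<in> carrier A"
  by (induction w arbitrary: x) auto

lemma wt_append:
  "u \<in> lists toks \<Longrightarrow> w \<in> lists toks \<Longrightarrow> wt (u @ w) x = wt u x \<otimes> wt w (tac u x)"
  by (induction u arbitrary: x) (auto simp: m_assoc)

lemma sec_toks: "w \<in> lists toks \<Longrightarrow> sec b w \<in> lists toks"
  by (induction b w rule: sec.induct) auto

lemma wt_scons: "w \<in> lists toks \<Longrightarrow> wt w (scons b u) = wt (sec b w) u"
  by (induction b w arbitrary: u rule: sec.induct) (auto simp: sec_toks)

definition elem :: "'a tok list \<Rightarrow> (seq \<Rightarrow> 'a) \<times> (seq \<Rightarrow> seq)" where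
  "elem w = (wt w, tac w)"

lemma twt_outside: "x \<notin> Xorb \<Longrightarrow> twt t x = \<one>"
  by (cases t) auto

lemma wt_outside: "x \<notin> Xorb \<Longrightarrow> wt w x = \<one>"
  by (induction w arbitrary: x) (auto simp: twt_outside)

lemma wt_finite_support: "finite {x. wt w x \<noteq> \<one>}"
proof (induction w)
  case (Cons t w)
  have "{x. wt (t # w) x \<noteq> \<one>} \<subseteq> {rho} \<union> tact t -` {x. wt w x \<noteq> \<one>}"
    by (cases t) auto
  then show ?case
    using Cons finite_vimageI[OF _ inj_tact] by (meson finite.emptyI finite_UnI finite_insert finite_subset)
qed simp

lemma W_carrier: "(f, g) \<in> carrier W \<longleftrightarrow> g \<in> carrier Grig \<and> (\<forall>x. f x \<in> carrier A)
    \<and> (\<forall>x. x \<notin> Xorb \<longrightarrow> f x = \<one>) \<and> finite {x. f x \<noteq> \<one>}"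
  by (auto simp: W_def wreath_def)

lemma W_mult: "(f, g) \<in> carrier W \<Longrightarrow> (f', g') \<in> carrier W \<Longrightarrow>
    (f, g) \<otimes>\<^bsub>W\<^esub> (f', g') = ((\<lambda>x. f x \<otimes> f' (g x)), g' \<circ> g)"
  unfolding W_carrier
  by (auto simp: W_def wreath_def fun_eq_iff elim!: Grig_cases)

lemma W_one: "\<one>\<^bsub>W\<^esub> = ((\<lambda>_. \<one>), id)"
  by (simp add: W_def wreath_def)

lemma elem_closed [simp]: "w \<in> lists toks \<Longrightarrow> elem w \<in> carrier W"
  by (simp add: elem_def W_carrier tac_in_Grig wt_outside wt_finite_support)

lemma elem_Nil: "elem [] = \<one>\<^bsub>W\<^esub>"
  by (auto simp: elem_def W_one)

lemma elem_append:
  assumes "u \<in> lists toks" "w \<in> lists toks"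
  shows "elem (u @ w) = elem u \<otimes>\<^bsub>W\<^esub> elem w"
  using elem_closed[OF assms(1)] elem_closed[OF assms(2)] assms
  by (simp add: elem_def W_mult wt_append fun_eq_iff)

end

subsection \<open>Inverted orbits\<close>

text \<open>The points \<open>\<rho> (s\<^sub>1 \<dots> s\<^sub>i)\<inverse>\<close> at which a generator of \<open>A\<close> inserted after
  \<open>s\<^sub>1 \<dots> s\<^sub>i\<close> acts (an inverted orbit).\<close>
fun pts :: "ggen list \<Rightarrow> seq set" where
  "pts [] = {rho}"
| "pts (s # w) = insert rho (gact s ` pts w)"

lemma finite_pts [simp]: "finite (pts w)"
  by (induction w) auto

lemma rho_in_pts [simp]: "rho \<in> pts w"
  by (cases w) auto

lemma pts_append: "pts (u @ w) = pts u \<union> wact (rev u) ` pts w"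
  by (induction u) (auto simp: image_Un image_image)

context wreath_base
begin

fun gtok :: "ggen \<Rightarrow> 'a tok" where
  "gtok GA = TA"
| "gtok s = TV (gen_v4 s) \<one>"

lemma tact_gtok [simp]: "tact (gtok s) x = gact s x"
  by (cases s) auto

lemma twt_gtok [simp]: "twt (gtok s) x = \<one>"
  by (cases s) auto

lemma gtok_toks [simp]: "gtok s \<in> toks"
  by (cases s) auto

end

subsection \<open>Word growth\<close>

definition ball :: "('a, 'm) monoid_scheme \<Rightarrow> 'a set \<Rightarrow> nat \<Rightarrow> 'a set" where
  "ball G S n = {word_eval G xs | xs.
      set xs \<subseteq> S \<union> (\<lambda>s. inv\<^bsub>G\<^esub> s) ` S \<and> length xs \<le> n}"

lemma growth_eq_card_ball: "growth G S n = real (card (ball G S n))"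
  by (simp add: growth_def ball_def)

lemma word_eval_Nil [simp]: "word_eval G [] = \<one>\<^bsub>G\<^esub>"
  and word_eval_Cons [simp]: "word_eval G (x # xs) = x \<otimes>\<^bsub>G\<^esub> word_eval G xs"
  by (simp_all add: word_eval_def)

lemma ball_mono: "m \<le> n \<Longrightarrow> ball G S m \<subseteq> ball G S n"
  unfolding ball_def using order_trans by blast

lemma ball_ind [consumes 1, case_names one mult]:
  assumes "g \<in> ball G S n"
    and "\<And>n. P \<one>\<^bsub>G\<^esub> n"
    and "\<And>s g n. s \<in> S \<union> (\<lambda>s. inv\<^bsub>G\<^esub> s) ` S \<Longrightarrow> g \<in> ball G S n \<Longrightarrow> P g n \<Longrightarrow> P (s \<otimes>\<^bsub>G\<^esub> g) (Suc n)"
  shows "P g n"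
proof -
  obtain xs where xs: "g = word_eval G xs" "set xs \<subseteq> S \<union> (\<lambda>s. inv\<^bsub>G\<^esub> s) ` S" "length xs \<le> n"
    using assms(1) by (auto simp: ball_def)
  have "P (word_eval G xs) n"
    using xs(2,3)
  proof (induction xs arbitrary: n)
    case (Cons x xs)
    then obtain m where "n = Suc m" "length xs \<le> m"
      by (cases n) auto
    then show ?case
      using Cons by (auto intro!: assms(3) simp: ball_def)
  qed (simp add: assms(2))
  then show ?thesis
    using xs by simp
qed

text \<open>Kept apart from \<open>gen_group\<close> because generation of the wreath product is
  itself deduced from a statement about balls, \<open>realize\<close>.\<close>

locale gen_set = group G for G (structure) +
  fixes S
  assumes finite_S: "finite S" and S_carrier: "S \<subseteq> carrier G"
begin

lemma sym_carrier: "S \<union> (\<lambda>s. inv s) ` S \<subseteq> carrier G"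
  using S_carrier by auto

lemma finite_sym: "finite (S \<union> (\<lambda>s. inv s) ` S)"
  using finite_S by simp

lemma word_eval_closed: "set xs \<subseteq> carrier G \<Longrightarrow> word_eval G xs \<in> carrier G"
  by (induction xs) auto

lemma word_eval_append:
  "set xs \<subseteq> carrier G \<Longrightarrow> set ys \<subseteq> carrier G \<Longrightarrow> word_eval G (xs @ ys) = word_eval G xs \<otimes> word_eval G ys"
  by (induction xs) (auto simp: word_eval_closed m_assoc)

lemma ball_carrier: "ball G S n \<subseteq> carrier G"
  unfolding ball_def using sym_carrier word_eval_closed by blast

lemma finite_ball [simp]: "finite (ball G S n)"
proof -
  have "ball G S n = word_eval G ` {xs. set xs \<subseteq> S \<union> (\<lambda>s. inv s) ` S \<and> length xs \<le> n}"
    by (auto simp: ball_def)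
  then show ?thesis
    using finite_lists_length_le[OF finite_sym] by simp
qed

lemma one_in_ball [simp]: "\<one> \<in> ball G S n"
  by (auto simp: ball_def intro!: exI[of _ "[]"])

lemma mult_in_ball:
  assumes "g \<in> ball G S m" "h \<in> ball G S n"
  shows "g \<otimes> h \<in> ball G S (m + n)"
proof -
  obtain xs ys where xs: "g = word_eval G xs" "set xs \<subseteq> S \<union> (\<lambda>s. inv s) ` S" "length xs \<le> m"
    and ys: "h = word_eval G ys" "set ys \<subseteq> S \<union> (\<lambda>s. inv s) ` S" "length ys \<le> n"
    using assms by (auto simp: ball_def)
  have "g \<otimes> h = word_eval G (xs @ ys)"
    using xs(1,2) ys(1,2) sym_carrier word_eval_append[of xs ys] by (metis subset_trans)
  moreover have "set (xs @ ys) \<subseteq> S \<union> (\<lambda>s. inv s) ` S" "length (xs @ ys) \<le> m + n"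
    using xs ys by auto
  ultimately show ?thesis
    unfolding ball_def by blast
qed

lemma sym_in_ball: "s \<in> S \<union> (\<lambda>s. inv s) ` S \<Longrightarrow> s \<in> ball G S 1"
proof -
  assume s: "s \<in> S \<union> (\<lambda>s. inv s) ` S"
  then have "s = word_eval G [s]"
    using sym_carrier by auto
  then show ?thesis
    unfolding ball_def using s by (intro CollectI exI[of _ "[s]"]) auto
qed

lemma ball_generate: "ball G S n \<subseteq> generate G S"
proof
  fix g assume "g \<in> ball G S n"
  then show "g \<in> generate G S"
    by (induction rule: ball_ind) (auto intro: generate.intros)
qed

end

locale gen_group = gen_set G S for G (structure) and S +
  assumes generate_S: "generate G S = carrier G"
begin

lemma carrier_eq_Union_ball: "carrier G = (\<Union>n. ball G S n)"
proof (intro equalityI subsetI)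
  fix g assume "g \<in> carrier G"
  then have "g \<in> generate G S"
    using generate_S by simp
  then show "g \<in> (\<Union>n. ball G S n)"
  proof induction
    case (incl h)
    then show ?case
      using sym_in_ball by blast
  next
    case (inv h)
    then show ?case
      using sym_in_ball by blast
  next
    case (eng h1 h2)
    then obtain m n where "h1 \<in> ball G S m" "h2 \<in> ball G S n"
      by blast
    then show ?case
      using mult_in_ball by blast
  qed auto
qed (use ball_carrier in auto)

definition len :: "'a \<Rightarrow> nat" where
  "len g = (LEAST n. g \<in> ball G S n)"

lemma in_ball_iff: "g \<in> ball G S n \<longleftrightarrow> g \<in> carrier G \<and> len g \<le> n"
proof
  assume g: "g \<in> ball G S n"
  then have "len g \<le> n"
    unfolding len_def by (rule Least_le)
  then show "g \<in> carrier G \<and> len g \<le> n"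
    using g ball_carrier by blast
next
  assume g: "g \<in> carrier G \<and> len g \<le> n"
  then obtain m where "g \<in> ball G S m"
    using carrier_eq_Union_ball by blast
  then have "g \<in> ball G S (len g)"
    unfolding len_def by (rule LeastI)
  then show "g \<in> ball G S n"
    using ball_mono[of "len g" n G S] g by blast
qed

lemma len_one [simp]: "len \<one> = 0"
  using one_in_ball[of 0] in_ball_iff[of "\<one>" 0] by simp

lemma len_mult: "g \<in> carrier G \<Longrightarrow> h \<in> carrier G \<Longrightarrow> len (g \<otimes> h) \<le> len g + len h"
  using mult_in_ball[of g "len g" h "len h"] by (simp add: in_ball_iff)

lemma len_sym: "s \<in> S \<union> (\<lambda>s. inv s) ` S \<Longrightarrow> len s \<le> 1"
  using sym_in_ball[of s] in_ball_iff[of s 1] by blast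

end

subsection \<open>Generation of the wreath product\<close>

context wreath_base
begin

lemma group_W: "group W"
proof (rule groupI)
  fix x y assume "x \<in> carrier W" "y \<in> carrier W"
  then obtain f u f' v where x: "x = (f, wact u)" "(f, wact u) \<in> carrier W"
    and y: "y = (f', wact v)" "(f', wact v) \<in> carrier W"
    by (metis Grig_cases W_carrier prod.exhaust)
  have "{z. f z \<otimes> f' (wact u z) \<noteq> \<one>} \<subseteq> {z. f z \<noteq> \<one>} \<union> wact u -` {z. f' z \<noteq> \<one>}"
    using x y by (auto simp: W_carrier)
  moreover have "finite ({z. f z \<noteq> \<one>} \<union> wact u -` {z. f' z \<noteq> \<one>})"
    using x y finite_vimageI[OF _ inj_wact, of "{z. f' z \<noteq> \<one>}" u]
    by (simp only: W_carrier finite_Un)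
  ultimately have "finite {z. f z \<otimes> f' (wact u z) \<noteq> \<one>}"
    by (rule finite_subset)
  moreover have "wact v \<circ> wact u = wact (u @ v)"
    by (simp add: fun_eq_iff)
  then have "wact v \<circ> wact u \<in> carrier Grig"
    by (simp only: wact_in_Grig)
  ultimately show "x \<otimes>\<^bsub>W\<^esub> y \<in> carrier W"
    using x y by (simp add: W_mult) (simp add: W_carrier)
next
  show one: "\<one>\<^bsub>W\<^esub> \<in> carrier W"
    using elem_closed[of "[]"] by (simp add: elem_Nil)
  fix x assume "x \<in> carrier W"
  then show "\<one>\<^bsub>W\<^esub> \<otimes>\<^bsub>W\<^esub> x = x"
    using one by (cases x) (simp add: W_one W_mult, simp add: W_carrier)
next
  fix x y z assume "x \<in> carrier W" "y \<in> carrier W" "z \<in> carrier W"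
  then show "x \<otimes>\<^bsub>W\<^esub> y \<otimes>\<^bsub>W\<^esub> z = x \<otimes>\<^bsub>W\<^esub> (y \<otimes>\<^bsub>W\<^esub> z)"
    by (auto simp: W_def wreath_def m_assoc fun_eq_iff elim!: Grig_cases)
next
  fix x assume "x \<in> carrier W"
  then obtain f u where x: "x = (f, wact u)" "(f, wact u) \<in> carrier W"
    by (metis Grig_cases W_carrier prod.exhaust)
  have "{z. inv (f (wact (rev u) z)) \<noteq> \<one>} \<subseteq> wact (rev u) -` {z. f z \<noteq> \<one>}"
    using x by auto
  then have "finite {z. inv (f (wact (rev u) z)) \<noteq> \<one>}"
    using x finite_vimageI[OF _ inj_wact, of "{z. f z \<noteq> \<one>}" "rev u"]
    by (simp only: W_carrier finite_subset)
  then have y: "(\<lambda>z. inv (f (wact (rev u) z)), wact (rev u)) \<in> carrier W"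
    using x by (simp add: W_carrier)
  moreover have "(\<lambda>z. inv (f (wact (rev u) z)), wact (rev u)) \<otimes>\<^bsub>W\<^esub> x = \<one>\<^bsub>W\<^esub>"
    using x y by (simp add: W_mult) (simp add: W_carrier W_one fun_eq_iff)
  ultimately show "\<exists>y\<in>carrier W. y \<otimes>\<^bsub>W\<^esub> x = \<one>\<^bsub>W\<^esub>"
    by blast
qed

end

locale wreath_gen = gen_group A S + wreath_base A for A (structure) and S
begin

definition SW :: "((seq \<Rightarrow> 'a) \<times> (seq \<Rightarrow> seq)) set" where
  "SW = (\<lambda>s. elem [gtok s]) ` UNIV \<union> (\<lambda>s. elem [TV VE s]) ` S"

sublocale W: group W
  by (rule group_W)

lemma elem_gtok_inv: "inv\<^bsub>W\<^esub> (elem [gtok s]) = elem [gtok s]"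
proof (rule W.inv_equality)
  have "elem [gtok s] \<otimes>\<^bsub>W\<^esub> elem [gtok s] = elem [gtok s, gtok s]"
    using elem_append[of "[gtok s]" "[gtok s]"] by simp
  also have "\<dots> = \<one>\<^bsub>W\<^esub>"
    by (simp add: elem_def W_one fun_eq_iff)
  finally show "elem [gtok s] \<otimes>\<^bsub>W\<^esub> elem [gtok s] = \<one>\<^bsub>W\<^esub>" .
qed simp_all

lemma elem_TV_mult:
  "s \<in> carrier A \<Longrightarrow> r \<in> carrier A \<Longrightarrow> elem [TV VE s] \<otimes>\<^bsub>W\<^esub> elem [TV VE r] = elem [TV VE (s \<otimes> r)]"
  by (subst elem_append[symmetric]) (simp_all add: elem_def fun_eq_iff)

lemma elem_TV_one: "elem [TV VE \<one>] = \<one>\<^bsub>W\<^esub>"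
  by (simp add: elem_def W_one fun_eq_iff)

lemma elem_TV_inv:
  "s \<in> carrier A \<Longrightarrow> inv\<^bsub>W\<^esub> (elem [TV VE s]) = elem [TV VE (inv s)]"
  by (rule W.inv_equality) (simp_all add: elem_TV_mult elem_TV_one)

lemma finite_ggen: "finite (UNIV :: ggen set)"
proof -
  have "(UNIV :: ggen set) = {GA, GB, GC, GD}"
    using ggen.exhaust by auto
  then show ?thesis
    by (metis finite.emptyI finite_insert)
qed

lemma finite_SW: "finite SW"
  using finite_ggen finite_S by (simp add: SW_def)

lemma SW_carrier: "SW \<subseteq> carrier W"
  using S_carrier by (auto simp: SW_def)

lemma SW_inv: "x \<in> SW \<union> (\<lambda>s. inv\<^bsub>W\<^esub> s) ` SW \<longleftrightarrow>
    (\<exists>s. x = elem [gtok s]) \<or> (\<exists>s \<in> S \<union> (\<lambda>s. inv s) ` S. x = elem [TV VE s])"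
proof -
  have "(\<lambda>s. inv\<^bsub>W\<^esub> s) ` SW = (\<lambda>s. elem [gtok s]) ` UNIV \<union> (\<lambda>s. elem [TV VE s]) ` (\<lambda>s. inv s) ` S"
    unfolding SW_def image_Un image_image elem_gtok_inv using S_carrier
    by (auto simp: elem_TV_inv subset_iff)
  then show ?thesis
    unfolding SW_def by blast
qed

interpretation WS: gen_set W SW
  by unfold_locales (rule finite_SW SW_carrier)+

lemma TV_in_ball:
  assumes "s \<in> carrier A"
  shows "elem [TV VE s] \<in> ball W SW (len s)"
proof -
  have "s \<in> ball A S (len s)"
    using assms by (simp add: in_ball_iff)
  then show ?thesis
  proof (induction rule: ball_ind)
    case (one n)
    then show ?case
      by (simp add: elem_TV_one)
  next
    case (mult s g n)
    then have closed: "s \<in> carrier A" "g \<in> carrier A"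
      using sym_carrier ball_carrier by blast+
    have "elem [TV VE s] \<in> ball W SW 1"
      by (rule WS.sym_in_ball) (subst SW_inv, use mult.hyps in blast)
    then have "elem [TV VE s] \<otimes>\<^bsub>W\<^esub> elem [TV VE g] \<in> ball W SW (1 + n)"
      using mult.IH by (rule WS.mult_in_ball)
    then show ?case
      using closed by (simp add: elem_TV_mult)
  qed
qed

text \<open>Built from the end of the word: prepending \<open>s\<close> carries the values already
  placed along \<open>gact s\<close>, and \<rho>, if still uncovered, receives its value from a
  block inserted in front. Each point is paid for once.\<close>

lemma realize:
  assumes "\<And>x. h x \<in> carrier A" and "\<And>x. x \<notin> pts w \<Longrightarrow> h x = \<one>"
  shows "(h, wact w) \<in> ball W SW (length w + (\<Sum>x\<in>pts w. len (h x)))"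
  using assms
proof (induction w arbitrary: h)
  case Nil
  have "(h, wact []) = elem [TV VE (h rho)]"
    using Nil.prems by (auto simp: elem_def)
  then show ?case
    using TV_in_ball[of "h rho"] Nil.prems by (simp del: wact_Nil)
next
  case (Cons s w)
  \<comment> \<open>The function demanded of the tail: \<open>h\<close> pulled back along
    \<open>s\<close> and cut off outside the points that the tail visits.\<close>
  define h' where "h' y = (if y \<in> pts w then h (gact s y) else \<one>)" for y
  have mem_iff: "x \<in> gact s ` pts w \<longleftrightarrow> gact s x \<in> pts w" for x
  proof
    assume "gact s x \<in> pts w"
    then have "gact s (gact s x) \<in> gact s ` pts w"
      by (rule imageI)
    then show "x \<in> gact s ` pts w"
      by simp
  qed auto
  have IH: "(h', wact w) \<in> ball W SW (length w + (\<Sum>x\<in>pts w. len (h' x)))"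
    by (rule Cons.IH) (simp_all add: h'_def Cons.prems(1))
  have "elem [gtok s] \<in> ball W SW 1"
    by (rule WS.sym_in_ball) (subst SW_inv, blast)
  then have "elem [gtok s] \<otimes>\<^bsub>W\<^esub> (h', wact w)
      \<in> ball W SW (1 + (length w + (\<Sum>x\<in>pts w. len (h' x))))"
    using IH by (rule WS.mult_in_ball)
  \<comment> \<open>What the tail yields after \<open>s\<close> is prepended. It agrees with
    \<open>h\<close> except possibly at \<rho>, and there too if \<rho> lies in the image.\<close>
  moreover define k where "k x = (if x \<in> gact s ` pts w then h x else \<one>)" for x
  have "elem [gtok s] \<otimes>\<^bsub>W\<^esub> (h', wact w) = (k, wact (s # w))"
  proof -
    have "elem [gtok s] = ((\<lambda>_. \<one>), gact s)"
      by (auto simp: elem_def)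
    moreover have "(h', wact w) \<in> carrier W"
      using IH WS.ball_carrier by blast
    moreover have "elem [gtok s] \<in> carrier W"
      by simp
    ultimately have "elem [gtok s] \<otimes>\<^bsub>W\<^esub> (h', wact w) = ((\<lambda>x. \<one> \<otimes> h' (gact s x)), wact w \<circ> gact s)"
      by (simp only: W_mult)
    then show ?thesis
      using Cons.prems(1) by (auto simp: h'_def k_def fun_eq_iff mem_iff)
  qed
  moreover have "(\<Sum>x\<in>pts w. len (h' x)) = (\<Sum>x\<in>gact s ` pts w. len (h x))"
    by (subst sum.reindex[OF inj_on_subset[OF inj_gact subset_UNIV]]) (simp add: h'_def)
  ultimately have k_ball:
    "(k, wact (s # w)) \<in> ball W SW (length (s # w) + (\<Sum>x\<in>gact s ` pts w. len (h x)))"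
    by simp
  show ?case
  proof (cases "rho \<in> gact s ` pts w")
    case True
    have "k = h"
    proof (intro ext)
      fix x
      show "k x = h x"
        using Cons.prems(2)[of x] True by (cases "x = rho") (simp_all add: k_def)
    qed
    then show ?thesis
      using k_ball True by (simp add: insert_absorb del: wact_Cons)
  next
    case False
    have "elem [TV VE (h rho)] \<otimes>\<^bsub>W\<^esub> (k, wact (s # w))
        \<in> ball W SW (len (h rho) + (length (s # w) + (\<Sum>x\<in>gact s ` pts w. len (h x))))"
      using TV_in_ball[OF Cons.prems(1)] k_ball by (rule WS.mult_in_ball)
    moreover have "elem [TV VE (h rho)] \<otimes>\<^bsub>W\<^esub> (k, wact (s # w)) = (h, wact (s # w))"
    proof -
      have "elem [TV VE (h rho)] = ((\<lambda>x. if x = rho then h rho else \<one>), id)"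
        using Cons.prems(1) by (auto simp: elem_def)
      moreover have "(k, wact (s # w)) \<in> carrier W"
        using k_ball WS.ball_carrier by blast
      moreover have "elem [TV VE (h rho)] \<in> carrier W"
        using Cons.prems(1) by simp
      ultimately have "elem [TV VE (h rho)] \<otimes>\<^bsub>W\<^esub> (k, wact (s # w))
          = ((\<lambda>x. (if x = rho then h rho else \<one>) \<otimes> k (id x)), wact (s # w) \<circ> id)"
        by (simp only: W_mult)
      moreover have "(if x = rho then h rho else \<one>) \<otimes> k (id x) = h x" for x
        using Cons.prems False by (auto simp: k_def)
      ultimately show ?thesis
        by simp
    qed
    ultimately show ?thesis
      using False by (simp add: add.commute add.left_commute del: wact_Cons)
  qed
qed

text \<open>The detour \<open>rev u @ u\<close> acts trivially, so it adds the point
  \<open>wact u rho\<close> while keeping the points already visited and the element of the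
  group.\<close>

lemma pts_cover:
  assumes "finite F" "F \<subseteq> Xorb"
  shows "\<exists>w. F \<subseteq> pts w \<and> wact w = id"
  using assms
proof induction
  case empty
  have "wact [] = id"
    by auto
  then show ?case
    by blast
next
  case (insert x F)
  then obtain w where w: "F \<subseteq> pts w" "wact w = id"
    by blast
  obtain u where u: "x = wact u rho"
    using insert.prems Xorb_iff by blast
  have "wact u rho \<in> pts (rev u @ u @ w)"
    unfolding pts_append by (auto simp: pts_append)
  moreover have "pts w \<subseteq> pts (rev u @ u @ w)"
    by (auto simp: pts_append image_Un image_image)
  moreover have "wact (rev u @ u @ w) = id"
    by (rule ext) (simp add: w)
  moreover have "insert x F \<subseteq> pts (rev u @ u @ w)"
    using calculation(1) subset_trans[OF w(1) calculation(2)] u by simp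
  ultimately show ?case
    by (intro exI[of _ "rev u @ u @ w"] conjI)
qed

text \<open>A trivially acting word covering the support of \<open>f\<close>, followed by a word for
  the \<Gamma>-component, satisfies the hypotheses of \<open>realize\<close>.\<close>

lemma generate_SW: "generate W SW = carrier W"
proof
  show "generate W SW \<subseteq> carrier W"
    by (rule W.generate_incl[OF SW_carrier])
  show "carrier W \<subseteq> generate W SW"
  proof
    fix x assume "x \<in> carrier W"
    then obtain f u where x: "x = (f, wact u)" "(f, wact u) \<in> carrier W"
      by (metis Grig_cases W_carrier prod.exhaust)
    then have f: "\<And>x. f x \<in> carrier A" "{x. f x \<noteq> \<one>} \<subseteq> Xorb" "finite {x. f x \<noteq> \<one>}"
      by (auto simp: W_carrier)
    obtain w where w: "{x. f x \<noteq> \<one>} \<subseteq> pts w" "wact w = id"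
      using pts_cover[OF f(3,2)] by (elim exE conjE)
    have "pts w \<subseteq> pts (w @ u)"
      by (auto simp: pts_append)
    then have "(f, wact (w @ u)) \<in> ball W SW (length (w @ u) + (\<Sum>x\<in>pts (w @ u). len (f x)))"
      using w f(1) by (intro realize) auto
    moreover have "wact (w @ u) = wact u"
      by (rule ext) (simp add: w)
    ultimately have "x \<in> ball W SW (length (w @ u) + (\<Sum>x\<in>pts (w @ u). len (f x)))"
      by (simp only: x(1))
    then show "x \<in> generate W SW"
      by (rule subsetD[OF WS.ball_generate])
  qed
qed

end

sublocale wreath_gen \<subseteq> WS: gen_group W SW
  by unfold_locales (rule finite_SW SW_carrier generate_SW)+

subsection \<open>The contracting norm\<close>

lemma eta_ex1: "\<exists>!t::real. t ^ 3 + t ^ 2 + t - 2 = 0"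
  and eta_between: "\<And>t::real. t ^ 3 + t ^ 2 + t - 2 = 0 \<Longrightarrow> 0 < t \<and> t < 1"
proof -
  have inj: "s = t" if "s ^ 3 + s ^ 2 + s - 2 = 0" "t ^ 3 + t ^ 2 + t - 2 = 0" for s t :: real
  proof -
    \<comment> \<open>Twice the difference quotient of the cubic is a sum of squares plus 1, hence
      nonzero.\<close>
    have "(t - s) * ((t + s + 1)\<^sup>2 + t\<^sup>2 + s\<^sup>2 + 1) = 2 * (t ^ 3 + t ^ 2 + t - (s ^ 3 + s ^ 2 + s))"
      by (simp add: power2_eq_square power3_eq_cube algebra_simps)
    also have "\<dots> = 0"
      using that by simp
    finally have "t - s = 0 \<or> (t + s + 1)\<^sup>2 + t\<^sup>2 + s\<^sup>2 + 1 = 0"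
      by simp
    moreover have "(t + s + 1)\<^sup>2 + t\<^sup>2 + s\<^sup>2 + 1 > 0"
      by (simp add: add_nonneg_pos)
    ultimately show ?thesis
      by simp
  qed
  have "\<exists>t::real. 0 \<le> t \<and> t \<le> 1 \<and> t ^ 3 + t ^ 2 + t - 2 = 0"
    by (rule IVT[of "\<lambda>t::real. t ^ 3 + t ^ 2 + t - 2" 0 0 1]) (auto intro!: continuous_intros)
  then obtain t :: real where t: "0 \<le> t" "t \<le> 1" "t ^ 3 + t ^ 2 + t - 2 = 0"
    by (elim exE conjE)
  show "\<exists>!t::real. t ^ 3 + t ^ 2 + t - 2 = 0"
    using t(3) by (rule ex1I) (rule inj[OF _ t(3)])
  show "0 < s \<and> s < 1" if "s ^ 3 + s ^ 2 + s - 2 = 0" for s :: real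
  proof -
    have "s = t"
      using that t(3) by (rule inj)
    moreover have "t \<noteq> 0" "t \<noteq> 1"
      using t(3) by auto
    ultimately show ?thesis
      using t by simp
  qed
qed

lemma eta_root: "eta ^ 3 + eta ^ 2 + eta = 2"
proof -
  have "eta ^ 3 + eta ^ 2 + eta - 2 = 0"
    unfolding eta_def by (rule theI'[OF eta_ex1])
  then show ?thesis
    by simp
qed

lemma eta_pos [simp]: "0 < eta" and eta_less_1 [simp]: "eta < 1"
proof -
  have "eta ^ 3 + eta ^ 2 + eta - 2 = 0"
    using eta_root by simp
  from eta_between[OF this] show "0 < eta" "eta < 1"
    by auto
qed

lemma eta_nonneg [simp]: "0 \<le> eta"
  by (rule less_imp_le) simp

lemma eta_neq_0 [simp]: "eta \<noteq> 0"
  using eta_pos by linarith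

lemma eta_le_1 [simp]: "eta \<le> 1"
  by (rule less_imp_le) simp

section \<open>Weights of the letters and their contraction\<close>

definition na :: real where
  "na = 1 - eta ^ 3"

lemma na_pos [simp]: "0 < na" and na_le_1: "na \<le> 1"
  by (simp_all add: na_def power_less_one_iff)

fun nv :: "v4 \<Rightarrow> real" where
  "nv VE = 0"
| "nv VB = eta ^ 3"
| "nv VC = 1 - eta ^ 2"
| "nv VD = 1 - eta"

lemma eta_powers: "eta ^ 3 = 2 - eta - eta ^ 2" "eta ^ 2 < eta" "0 < eta ^ 3" "eta ^ 3 < 1" "0 < eta ^ 2" "eta ^ 2 < 1"
proof -
  show "eta ^ 2 < eta"
    using mult_strict_right_mono[OF eta_less_1 eta_pos] by (simp add: power2_eq_square)
  then show "eta ^ 2 < 1"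
    using eta_less_1 by linarith
  show "0 < eta ^ 2" "0 < eta ^ 3"
    by (rule zero_less_power[OF eta_pos])+
  show "eta ^ 3 < 1"
    by (simp add: power_less_one_iff)
qed (use eta_root in simp)

lemma nv_nonneg [simp]: "0 \<le> nv v" and nv_le_1: "nv v \<le> 1"
  using eta_powers by (cases v; simp add: less_imp_le)+

text \<open>By the equation of \<open>eta\<close>, \<open>b\<close> weighs exactly as much as
  \<open>c\<close> and \<open>d\<close> together, which gives the triangle inequality among the
  three. Hence merging adjacent letters never increases the weight.\<close>

lemma nv_vmul: "nv (vmul v w) \<le> nv v + nv w"
  using eta_powers eta_pos eta_less_1
  by (cases v; cases w; simp only: vmul.simps nv.simps; linarith)

text \<open>An equality for \<open>b, c, d\<close>: both sides are \<open>eta\<close>,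
  \<open>eta^2\<close>, \<open>eta^3\<close> by the equation of \<open>eta\<close>. For the identity
  the left side is 0.\<close>

lemma nv_contraction: "nv (vph v) + (if vom v then na else 0) \<le> eta * (na + nv v)"
proof -
  have eq: "eta * eta ^ 3 = 2 * eta - eta ^ 2 - eta ^ 3" "eta * eta ^ 2 = eta ^ 3" "eta * eta = eta ^ 2"
    using arg_cong[OF eta_root, of "(*) eta"]
    by (simp_all add: power2_eq_square power3_eq_cube algebra_simps)
  show ?thesis
    using eta_powers eta_pos eq
    by (cases v) (auto simp: na_def algebra_simps)
qed

fun tn :: "'a tok \<Rightarrow> real" where
  "tn TA = na"
| "tn (TV v s) = nv v"

definition tnorm :: "'a tok list \<Rightarrow> real" where
  "tnorm w = sum_list (map tn w)"

lemma tnorm_Nil [simp]: "tnorm [] = 0"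
  and tnorm_Cons [simp]: "tnorm (t # w) = tn t + tnorm w"
  and tnorm_append [simp]: "tnorm (u @ w) = tnorm u + tnorm w"
  by (simp_all add: tnorm_def)

lemma tn_nonneg [simp]: "0 \<le> tn t" and tn_le_1: "tn t \<le> 1"
  using na_le_1 nv_le_1 less_imp_le[OF na_pos] by (cases t; simp)+

lemma tnorm_nonneg [simp]: "0 \<le> tnorm w"
  by (induction w) auto

text \<open>The list \<open>[(v\<^sub>1, s\<^sub>1), \<dots>, (v\<^sub>m, s\<^sub>m)]\<close> encodes the word
  \<open>a (v\<^sub>1, s\<^sub>1) \<cdots> a (v\<^sub>m, s\<^sub>m)\<close>.\<close>
fun awd :: "(v4 \<times> 'a) list \<Rightarrow> 'a tok list" where
  "awd [] = []"
| "awd ((v, s) # qs) = TA # TV v s # awd qs"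

definition qnorm :: "(v4 \<times> 'a) list \<Rightarrow> real" where
  "qnorm qs = sum_list (map (\<lambda>q. na + nv (fst q)) qs)"

lemma qnorm_Nil [simp]: "qnorm [] = 0"
  and qnorm_Cons [simp]: "qnorm (q # qs) = na + nv (fst q) + qnorm qs"
  and qnorm_append [simp]: "qnorm (qs @ rs) = qnorm qs + qnorm rs"
  by (simp_all add: qnorm_def)

lemma length_le_qnorm: "na * real (length qs) \<le> qnorm qs"
  by (induction qs) (auto simp: algebra_simps add_increasing)

lemma awd_append [simp]: "awd (qs @ rs) = awd qs @ awd rs"
  by (induction qs rule: awd.induct) auto

lemma par_awd: "par b (awd qs) = (b \<noteq> odd (length qs))"
  by (induction qs arbitrary: b rule: awd.induct) auto

text \<open>An \<open>a\<close> of the word only exchanges the two states. The letter after it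
  contributes its sections, one to each side, so \<open>nv_contraction\<close> can be summed over
  the pairs.\<close>

lemma tnorm_sec_awd: "tnorm (sec b (awd qs)) + tnorm (sec (\<not> b) (awd qs)) \<le> eta * qnorm qs"
proof (induction qs arbitrary: b rule: awd.induct)
  case (2 v s qs)
  show ?case
    using nv_contraction[of v] "2.IH"[of True] "2.IH"[of False]
    by (cases b) (auto simp: algebra_simps split: if_splits)
qed simp

section \<open>Alternating normal forms\<close>

context wreath_base
begin

text \<open>The value \<open>((v, s), [(v\<^sub>1, s\<^sub>1), \<dots>, (v\<^sub>m, s\<^sub>m)])\<close>
  encodes the word \<open>(v, s) a (v\<^sub>1, s\<^sub>1) \<cdots> a (v\<^sub>m, s\<^sub>m)\<close>.\<close>

fun nf :: "'a tok list \<Rightarrow> (v4 \<times> 'a) \<times> (v4 \<times> 'a) list" where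
  "nf [] = ((VE, \<one>), [])"
| "nf (TA # w) = (case nf w of (q, qs) \<Rightarrow> ((VE, \<one>), q # qs))"
| "nf (TV v s # w) = (case nf w of ((v', s'), qs) \<Rightarrow> ((vmul v v', s \<otimes> s'), qs))"

fun unf :: "(v4 \<times> 'a) \<times> (v4 \<times> 'a) list \<Rightarrow> 'a tok list" where
  "unf ((v, s), qs) = TV v s # awd qs"

definition qtoks :: "(v4 \<times> 'a) set" where
  "qtoks = UNIV \<times> carrier A"

lemma qtoks_iff [simp]: "(v, s) \<in> qtoks \<longleftrightarrow> s \<in> carrier A"
  by (simp add: qtoks_def)

lemma awd_toks: "awd qs \<in> lists toks \<longleftrightarrow> qs \<in> lists qtoks"
  by (induction qs rule: awd.induct) auto

lemma nf_toks: "w \<in> lists toks \<Longrightarrow> nf w \<in> qtoks \<times> lists qtoks"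
  by (induction w rule: nf.induct) (auto split: prod.splits)

lemma unf_toks: "p \<in> qtoks \<times> lists qtoks \<Longrightarrow> unf p \<in> lists toks"
  by (cases p rule: unf.cases) (simp add: awd_toks)

lemma tnorm_awd: "tnorm (awd qs) = qnorm qs"
  by (induction qs rule: awd.induct) auto

lemma vmul_commute: "vmul v w = vmul w v"
  by (cases v; cases w) auto

lemma elem_eq_iff: "elem u = elem w \<longleftrightarrow> (\<forall>x. wt u x = wt w x) \<and> (\<forall>x. tac u x = tac w x)"
  unfolding elem_def by (metis ext prod.inject)

lemma elem_unf_nf: "w \<in> lists toks \<Longrightarrow> elem (unf (nf w)) = elem w"
proof (induction w rule: nf.induct)
  case 1
  then show ?case
    by (simp add: elem_eq_iff)
next
  case (2 w)
  then obtain v s qs where q: "nf w = ((v, s), qs)" "s \<in> carrier A" "qs \<in> lists qtoks"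
    using nf_toks[of w] by (cases "nf w") auto
  then show ?case
    using 2 by (auto simp: elem_eq_iff awd_toks[symmetric])
next
  case (3 v' s' w)
  then obtain v s qs where q: "nf w = ((v, s), qs)" "s \<in> carrier A" "qs \<in> lists qtoks"
    using nf_toks[of w] by (cases "nf w") auto
  have closed: "wt (awd qs) x \<in> carrier A" for x
    using q by (simp add: awd_toks)
  have w: "w \<in> lists toks" "s' \<in> carrier A"
    using 3 by auto
  have "elem (TV v s # awd qs) = elem w"
    using "3.IH" w q by simp
  then have IH: "wt w x = (if x = rho then s else \<one>) \<otimes> wt (awd qs) (vact v x)"
    "tac w x = tac (awd qs) (vact v x)" for x
    by (auto simp: elem_eq_iff)
  show ?case
    using w q closed by (simp add: elem_eq_iff IH vmul_commute[of v] m_assoc)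
qed

lemma tnorm_unf_nf: "tnorm (unf (nf w)) \<le> tnorm w"
proof (induction w rule: nf.induct)
  case (2 w)
  then show ?case
    by (cases "nf w") (auto simp: tnorm_awd)
next
  case (3 v' s' w)
  then show ?case
    using nv_vmul[of v' "fst (fst (nf w))"] by (cases "nf w") (auto simp: tnorm_awd)
qed simp

text \<open>Injectivity of the wreath recursion: every sequence is a first letter followed by a
  tail, so the action on first letters and the two sections fix both the function and the
  permutation.\<close>

lemma elem_eqI_sec:
  assumes "u \<in> lists toks" "w \<in> lists toks"
    and "\<And>b. par b u = par b w" "\<And>b. elem (sec b u) = elem (sec b w)"
  shows "elem u = elem w"
  unfolding elem_eq_iff
proof (intro conjI allI)
  fix x
  obtain b y where x: "x = scons b y"
    by (rule scons_exhaust)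
  show "wt u x = wt w x" "tac u x = tac w x"
    using assms(4)[of b] assms(1-3) unfolding x elem_eq_iff by (simp_all add: wt_scons tac_scons)
qed

end

subsection \<open>Torsion\<close>

definition tor :: "('a, 'm) monoid_scheme \<Rightarrow> 'a \<Rightarrow> bool" where
  "tor G x \<longleftrightarrow> (\<exists>n::nat. n > 0 \<and> x [^]\<^bsub>G\<^esub> n = \<one>\<^bsub>G\<^esub>)"

lemma torsion_group_iff_tor: "torsion_group G \<longleftrightarrow> (\<forall>x\<in>carrier G. tor G x)"
  by (simp add: torsion_group_def tor_def)

lemma (in group) tor_pow:
  assumes "x \<in> carrier G" "tor G (x [^] (n::nat))" "n > 0"
  shows "tor G x"
proof -
  obtain m :: nat where "m > 0" "(x [^] n) [^] m = \<one>"
    using assms(2) by (auto simp: tor_def)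
  then have "x [^] (n * m) = \<one>" "n * m > 0"
    using assms by (simp_all add: nat_pow_pow)
  then show ?thesis
    unfolding tor_def by blast
qed

lemma (in group) tor_commute:
  assumes x: "x \<in> carrier G" and y: "y \<in> carrier G" and "tor G (x \<otimes> y)"
  shows "tor G (y \<otimes> x)"
proof -
  obtain n :: nat where n: "n > 0" "(x \<otimes> y) [^] n = \<one>"
    using assms(3) by (auto simp: tor_def)
  have "(y \<otimes> x) [^] k \<otimes> y = y \<otimes> (x \<otimes> y) [^] k" for k :: nat
  proof (induction k)
    case (Suc k)
    have "(y \<otimes> x) [^] Suc k \<otimes> y = (y \<otimes> x) [^] k \<otimes> y \<otimes> (x \<otimes> y)"
      using x y by (simp add: m_assoc)
    also have "\<dots> = y \<otimes> (x \<otimes> y) [^] Suc k"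
      using x y Suc by (simp add: m_assoc)
    finally show ?case .
  qed (use y in simp)
  from this[of n] have "(y \<otimes> x) [^] n \<otimes> y = y"
    using n y by simp
  then have "(y \<otimes> x) [^] n = \<one>"
    using x y r_cancel_one' by (metis m_closed nat_pow_closed)
  then show ?thesis
    using n unfolding tor_def by blast
qed

definition wpow :: "'b list \<Rightarrow> nat \<Rightarrow> 'b list" where
  "wpow w n = concat (replicate n w)"

lemma wpow_0 [simp]: "wpow w 0 = []"
  and wpow_Suc: "wpow w (Suc n) = w @ wpow w n"
  by (simp_all add: wpow_def)

lemma par_wpow: "(\<And>b. par b w = b) \<Longrightarrow> par b (wpow w n) = b"
  by (induction n) (simp_all add: wpow_Suc par_append)

lemma sec_wpow: "(\<And>b. par b w = b) \<Longrightarrow> sec b (wpow w n) = wpow (sec b w) n"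
  by (induction n) (simp_all add: wpow_Suc sec_append)

context wreath_gen
begin

lemma wpow_toks: "w \<in> lists toks \<Longrightarrow> wpow w n \<in> lists toks"
  by (induction n) (simp_all add: wpow_Suc)

lemma elem_wpow: "w \<in> lists toks \<Longrightarrow> elem (wpow w n) = elem w [^]\<^bsub>W\<^esub> n"
proof (induction n)
  case (Suc n)
  then show ?case
    using elem_append[of w "wpow w n"] W.nat_pow_comm[of "elem w" n 1]
    by (simp add: wpow_Suc wpow_toks)
qed (simp add: elem_Nil)

text \<open>As the first letter is fixed, sections of powers are powers of sections; the product of
  exponents killing the two sections kills both.\<close>

lemma tor_of_sections:
  assumes w: "w \<in> lists toks" and par: "\<And>b. par b w = b" and tor: "\<And>b. tor W (elem (sec b w))"
  shows "tor W (elem w)"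
proof -
  obtain m n :: nat where m: "m > 0" "elem (sec True w) [^]\<^bsub>W\<^esub> m = \<one>\<^bsub>W\<^esub>"
    and n: "n > 0" "elem (sec False w) [^]\<^bsub>W\<^esub> n = \<one>\<^bsub>W\<^esub>"
    using tor[of True] tor[of False] by (auto simp: tor_def)
  have closed: "elem (sec b w) \<in> carrier W" for b
    using w by (simp add: sec_toks)
  have "elem (sec True w) [^]\<^bsub>W\<^esub> (m * n) = \<one>\<^bsub>W\<^esub>"
    unfolding W.nat_pow_pow[OF closed, symmetric] m by simp
  moreover have "elem (sec False w) [^]\<^bsub>W\<^esub> (m * n) = \<one>\<^bsub>W\<^esub>"
    unfolding mult.commute[of m] W.nat_pow_pow[OF closed, symmetric] n by simp
  ultimately have pow: "elem (sec b w) [^]\<^bsub>W\<^esub> (m * n) = \<one>\<^bsub>W\<^esub>" for b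
    by (cases b) simp_all
  have "elem (wpow w (m * n)) = elem []"
    by (rule elem_eqI_sec)
      (use w par pow in \<open>simp_all add: wpow_toks par_wpow sec_wpow elem_wpow sec_toks elem_Nil\<close>)
  then have "elem w [^]\<^bsub>W\<^esub> (m * n) = \<one>\<^bsub>W\<^esub>"
    using w by (simp add: elem_wpow elem_Nil)
  then show ?thesis
    using m n unfolding tor_def by (intro exI[of _ "m * n"]) simp
qed

text \<open>The square has trivial part in the four-group, so it lies in the copy of
  \<open>A\<close> at \<rho>.\<close>

lemma tor_TV:
  assumes "s \<in> carrier A" "tor A s"
  shows "tor W (elem [TV v s])"
proof -
  obtain n :: nat where n: "n > 0" "s [^] n = \<one>"
    using assms by (auto simp: tor_def)
  have pow: "elem [TV VE r] [^]\<^bsub>W\<^esub> k = elem [TV VE (r [^] k)]" if "r \<in> carrier A" for r and k :: nat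
    using that by (induction k) (simp_all add: elem_TV_mult elem_TV_one)
  have "elem [TV v s] [^]\<^bsub>W\<^esub> (2::nat) = elem [TV v s, TV v s]"
    using assms elem_append[of "[TV v s]" "[TV v s]"]
    by (simp add: numeral_2_eq_2)
  also have "\<dots> = elem [TV VE (s [^] (2::nat))]"
    using assms by (simp add: elem_eq_iff numeral_2_eq_2)
  also have "tor W \<dots>"
  proof -
    have "(s [^] (2::nat)) [^] n = \<one>"
      unfolding nat_pow_pow[OF assms(1)] mult.commute[of 2]
      unfolding nat_pow_pow[OF assms(1), symmetric] n by simp
    then have "elem [TV VE (s [^] (2::nat))] [^]\<^bsub>W\<^esub> n = \<one>\<^bsub>W\<^esub>"
      using assms by (simp add: pow elem_TV_one)
    then show ?thesis
      using n unfolding tor_def by (intro exI[of _ n]) simp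
  qed
  finally have "tor W (elem [TV v s] [^]\<^bsub>W\<^esub> (2::nat))" .
  then show ?thesis
    by (rule W.tor_pow[rotated]) (use assms in simp_all)
qed

text \<open>Up to conjugation, an initial letter of \<open>V\<^sub>4 \<times> A\<close> is absorbed by the last one.\<close>
lemma tor_by_awd:
  assumes w: "w \<in> lists toks" and A: "torsion_group A"
    and awd: "\<And>qs. qs \<in> lists qtoks \<Longrightarrow> qnorm qs \<le> tnorm w \<Longrightarrow> tor W (elem (awd qs))"
  shows "tor W (elem w)"
proof -
  obtain v s qs where q: "nf w = ((v, s), qs)" "s \<in> carrier A" "qs \<in> lists qtoks"
    using nf_toks[OF w] by (cases "nf w") auto
  have norm: "nv v + qnorm qs \<le> tnorm w"
    using tnorm_unf_nf[of w] q by (simp add: tnorm_awd)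
  have w_eq: "elem w = elem (TV v s # awd qs)"
    using elem_unf_nf[OF w] q by simp
  show ?thesis
  proof (cases qs rule: rev_cases)
    case Nil
    have "tor A s"
      using A q(2) by (simp add: torsion_group_iff_tor)
    then show ?thesis
      using tor_TV[OF q(2)] w_eq Nil by simp
  next
    case (snoc rs r)
    obtain v' s' where r: "r = (v', s')"
      by (cases r)
    have closed: "rs \<in> lists qtoks" "s' \<in> carrier A"
      using q snoc r by auto
    have "elem (awd qs @ [TV v s]) = elem (awd (rs @ [(vmul v' v, s' \<otimes> s)]))"
    proof -
      have "elem [TA, TV v' s', TV v s] = elem [TA, TV (vmul v' v) (s' \<otimes> s)]"
        using closed q by (simp add: elem_eq_iff vmul_commute[of v])
      moreover have "elem (awd qs @ [TV v s]) = elem (awd rs) \<otimes>\<^bsub>W\<^esub> elem [TA, TV v' s', TV v s]"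
        using elem_append[of "awd rs" "[TA, TV v' s', TV v s]"] closed q snoc r by (simp add: awd_toks)
      moreover have "elem (awd (rs @ [(vmul v' v, s' \<otimes> s)]))
          = elem (awd rs) \<otimes>\<^bsub>W\<^esub> elem [TA, TV (vmul v' v) (s' \<otimes> s)]"
        using elem_append[of "awd rs" "[TA, TV (vmul v' v) (s' \<otimes> s)]"] closed q by (simp add: awd_toks)
      ultimately show ?thesis
        by simp
    qed
    moreover have "tor W (elem (awd (rs @ [(vmul v' v, s' \<otimes> s)])))"
      using closed q norm nv_vmul[of v' v] by (intro awd) (auto simp: snoc r)
    ultimately have "tor W (elem (awd qs) \<otimes>\<^bsub>W\<^esub> elem [TV v s])"
      using elem_append[of "awd qs" "[TV v s]"] q by (simp add: awd_toks)
    then have "tor W (elem [TV v s] \<otimes>\<^bsub>W\<^esub> elem (awd qs))"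
      by (rule W.tor_commute[rotated 2]) (use q in \<open>simp_all add: awd_toks\<close>)
    then show ?thesis
      using elem_append[of "[TV v s]" "awd qs"] q w_eq by (simp add: awd_toks)
  qed
qed

text \<open>Every section considered has weight at most \<open>eta\<close> times that of the word,
  so the induction runs over powers of \<open>1 / eta\<close>. It stops below \<open>na\<close>,
  where not a single pair fits.\<close>

lemma tor_awd:
  assumes A: "torsion_group A"
  shows "qs \<in> lists qtoks \<Longrightarrow> qnorm qs < na * (1 / eta) ^ k \<Longrightarrow> tor W (elem (awd qs))"
proof (induction k arbitrary: qs)
  case 0
  have "na * real (length qs) < na * 1"
    by (rule le_less_trans[OF length_le_qnorm]) (use 0 in simp)
  then have "real (length qs) < 1"
    by (rule mult_less_cancel_left_pos[OF na_pos, THEN iffD1])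
  then have "qs = []"
    by simp
  then show ?case
    by (simp add: elem_Nil tor_def exI[of _ 1])
next
  case (Suc k)
  \<comment> \<open>An odd word swaps the two halves, so it is squared. A section of the square is
    the concatenation of the two sections of the word, and \<open>tnorm_sec_awd\<close> bounds
    precisely their total weight; squaring thus loses nothing.\<close>
  define u where "u = (if even (length qs) then awd qs else wpow (awd qs) 2)"
  have u: "u \<in> lists toks" and par: "par b u = b" for b
    using Suc.prems(1)
    by (simp_all add: u_def wpow_toks awd_toks par_awd par_append wpow_Suc numeral_2_eq_2)
  have "tnorm (sec b (awd qs)) \<le> eta * qnorm qs" for b
    using tnorm_sec_awd[of b qs] tnorm_nonneg[of "sec (\<not> b) (awd qs)"] by linarith
  then have norm: "tnorm (sec b u) \<le> eta * qnorm qs" for b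
    using tnorm_sec_awd[of b qs]
    by (auto simp: u_def wpow_Suc numeral_2_eq_2 sec_append par_awd)
  have less: "eta * qnorm qs < na * (1 / eta) ^ k"
    using Suc.prems(2) by (simp add: field_simps)
  have "tor W (elem (sec b u))" for b
  proof (rule tor_by_awd[OF sec_toks[OF u] A])
    fix rs assume "rs \<in> lists qtoks" "qnorm rs \<le> tnorm (sec b u)"
    then show "tor W (elem (awd rs))"
      using norm[of b] less by (intro Suc.IH) simp_all
  qed
  then have "tor W (elem u)"
    using u par by (rule tor_of_sections[rotated 2])
  then show ?case
    using Suc.prems(1) W.tor_pow[of "elem (awd qs)" 2]
    by (auto simp: u_def elem_wpow awd_toks split: if_splits)
qed

section \<open>Words for the elements of a ball\<close>

fun tlen :: "'a tok \<Rightarrow> nat" where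
  "tlen TA = 0"
| "tlen (TV v s) = len s"

definition alen :: "'a tok list \<Rightarrow> nat" where
  "alen w = sum_list (map tlen w)"

lemma alen_Nil [simp]: "alen [] = 0"
  and alen_Cons [simp]: "alen (t # w) = tlen t + alen w"
  and alen_append [simp]: "alen (u @ w) = alen u + alen w"
  by (simp_all add: alen_def)

text \<open>Two budgets are recorded at once: the weight, which will limit the number of letters
  after several levels, and the total length of the letters from \<open>A\<close>.\<close>

lemma ball_word:
  assumes "x \<in> ball W SW n"
  shows "\<exists>w. w \<in> lists toks \<and> x = elem w \<and> tnorm w \<le> real n \<and> alen w \<le> n"
  using assms
proof (induction rule: ball_ind)
  case (one n)
  show ?case
    by (rule exI[of _ "[]"]) (simp add: elem_Nil)
next
  case (mult s g n)
  then obtain w where w: "w \<in> lists toks" "g = elem w" "tnorm w \<le> real n" "alen w \<le> n"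
    by (elim exE conjE)
  obtain t where t: "t \<in> toks" "s = elem [t]" "tlen t \<le> 1"
  proof -
    consider (g) r where "s = elem [gtok r]" | (s) r where "r \<in> S \<union> (\<lambda>s. inv s) ` S" "s = elem [TV VE r]"
      using mult.hyps(1) unfolding SW_inv by (elim disjE exE bexE)
    then show thesis
    proof cases
      case g
      then show thesis
        by (intro that[of "gtok r"]) (cases r; simp)+
    next
      case s
      then show thesis
        using len_sym[of r] sym_carrier by (intro that[of "TV VE r"]) auto
    qed
  qed
  show ?case
    using w t tn_le_1[of t] elem_append[of "[t]" w] by (intro exI[of _ "t # w"]) simp
qed

lemma W_cases:
  assumes "x \<in> carrier W"
  obtains w where "w \<in> lists toks" "x = elem w"
proof -
  obtain n where "x \<in> ball W SW n"
    using assms unfolding WS.carrier_eq_Union_ball by (elim UN_E)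
  from ball_word[OF this] show thesis
    using that by (elim exE conjE)
qed

lemma torsion_W:
  assumes "torsion_group A"
  shows "torsion_group W"
  unfolding torsion_group_iff_tor
proof
  fix x assume "x \<in> carrier W"
  then obtain w where w: "w \<in> lists toks" "x = elem w"
    by (rule W_cases)
  have "tor W (elem (awd qs))" if "qs \<in> lists qtoks" for qs
  proof -
    obtain k where "qnorm qs / na < (1 / eta) ^ k"
      using real_arch_pow[of "1 / eta" "qnorm qs / na"] by auto
    then have "qnorm qs < na * (1 / eta) ^ k"
      by (simp add: field_simps)
    then show ?thesis
      by (rule tor_awd[OF assms that])
  qed
  then show "tor W x"
    using tor_by_awd[OF w(1) assms] w(2) by simp
qed

end

subsection \<open>Words with large inverted orbits\<close>

fun awords :: "ggen list \<Rightarrow> ggen list" where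
  "awords [] = []"
| "awords (s # w) = GA # s # awords w"

text \<open>Inverts the recursion on alternating words: for \<open>v = c, d\<close> the block
  \<open>awords (zeta v)\<close> has section \<open>a v\<close> in state 1 and \<open>v a\<close> in
  state 0. The block for \<open>b\<close> has odd length and flips the state; its sections are
  \<open>a b a\<close> and \<open>c d = b\<close>.\<close>

fun zeta :: "ggen \<Rightarrow> ggen list" where
  "zeta GA = []"
| "zeta GB = [GB, GD, GC]"
| "zeta GC = [GB, GB]"
| "zeta GD = [GC, GC]"

definition zsubst :: "ggen list \<Rightarrow> ggen list" where
  "zsubst w = concat (map zeta w)"

lemma zsubst_Nil [simp]: "zsubst [] = []"
  and zsubst_Cons [simp]: "zsubst (s # w) = zeta s @ zsubst w"
  by (simp_all add: zsubst_def)

lemma awords_append [simp]: "awords (u @ w) = awords u @ awords w"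
  by (induction u) auto

lemma length_awords [simp]: "length (awords w) = 2 * length w"
  by (induction w) auto

lemma in_pts_Cons: "x \<in> pts (s # w) \<longleftrightarrow> x = rho \<or> gact s x \<in> pts w"
proof -
  have "x \<in> gact s ` pts w \<longleftrightarrow> gact s x \<in> pts w"
  proof
    assume "gact s x \<in> pts w"
    then have "gact s (gact s x) \<in> gact s ` pts w"
      by (rule imageI)
    then show "x \<in> gact s ` pts w"
      by simp
  qed auto
  then show ?thesis
    by simp
qed

lemma gact_eq_rho_iff: "s \<noteq> GA \<Longrightarrow> gact s x = rho \<longleftrightarrow> x = rho"
  by (simp add: gact_vact)

lemma gact_GC_GD: "gact GD (gact GC x) = gact GB x"
  using vact_vact[of VD VC x] by simp

text \<open>The sections of \<open>awords (zsubst w)\<close> at 1 and 0 are, up to a final \<open>a\<close>,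
  \<open>awords w\<close> and \<open>awords w\<close> without its first letter.\<close>
lemma pts_zsubst:
  assumes "GA \<notin> set w"
  shows "x \<in> pts (awords w) \<Longrightarrow> scons True x \<in> pts (awords (zsubst w))"
    and "x \<in> pts (awords w) \<Longrightarrow> x = rho \<or> scons False (gact GA x) \<in> pts (awords (zsubst w))"
  using assms
proof (induction w arbitrary: x)
  case (Cons s w)
  {
    case 1
    then show ?case
      using Cons.IH[of "gact s (gact GA x)"]
      by (cases s) (auto simp: in_pts_Cons gact_eq_rho_iff simp del: pts.simps)
  next
    case 2
    then show ?case
      using Cons.IH[of "gact s (gact GA x)"]
      by (cases s) (auto simp: in_pts_Cons gact_eq_rho_iff gact_GC_GD simp del: pts.simps)
  }
qed (simp_all add: rho_scons[symmetric])

text \<open>The two families of points given by \<open>pts_zsubst\<close> are disjoint because their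
  first letters differ; the second misses only the image of \<rho>.\<close>

lemma card_pts_zsubst:
  assumes "GA \<notin> set w"
  shows "2 * card (pts (awords w)) \<le> card (pts (awords (zsubst w))) + 1"
proof -
  let ?P = "pts (awords w)"
  let ?X = "scons True ` ?P" and ?Y = "(\<lambda>x. scons False (gact GA x)) ` (?P - {rho})"
  have "?X \<union> ?Y \<subseteq> pts (awords (zsubst w))"
    using pts_zsubst[OF assms] by auto
  then have "card (?X \<union> ?Y) \<le> card (pts (awords (zsubst w)))"
    by (rule card_mono[OF finite_pts])
  moreover have "card (?X \<union> ?Y) = card ?X + card ?Y"
    by (rule card_Un_disjoint) auto
  moreover have "card ?X = card ?P"
    by (rule card_image) (simp add: inj_on_def)
  moreover have "card ?Y = card (?P - {rho})"
  proof (rule card_image, rule inj_onI)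
    fix x y assume "scons False (gact GA x) = scons False (gact GA y)"
    then show "x = y"
      using injD[OF inj_gact] by simp
  qed
  moreover have "card (?P - {rho}) = card ?P - 1"
    by simp
  ultimately show ?thesis
    by linarith
qed

section \<open>The iterated words and their lengths\<close>

definition zword :: "nat \<Rightarrow> ggen list" where
  "zword k = (zsubst ^^ k) [GB]"

lemma zword_0 [simp]: "zword 0 = [GB]"
  and zword_Suc [simp]: "zword (Suc k) = zsubst (zword k)"
  by (simp_all add: zword_def)

lemma GA_notin_zsubst: "GA \<notin> set (zsubst w)"
proof (induction w)
  case (Cons s w)
  then show ?case
    by (cases s) auto
qed simp

lemma GA_notin_zword: "GA \<notin> set (zword k)"
  by (cases k) (auto simp: GA_notin_zsubst)

text \<open>Iterating \<open>N -> 2 * N - 1\<close> from 2 gives \<open>2^k + 1\<close>.\<close>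

lemma card_pts_zword: "2 ^ k + 1 \<le> card (pts (awords (zword k)))"
proof (induction k)
  case 0
  have "gact GA rho \<noteq> rho"
    using gact_scons(1)[of True rho] by (simp add: rho_scons[symmetric])
  then have "card {rho, gact GA rho} = 2"
    by simp
  moreover have "card {rho, gact GA rho} \<le> card (pts (awords (zword 0)))"
    by (rule card_mono[OF finite_pts]) simp
  ultimately show ?case
    by simp
next
  case (Suc k)
  then show ?case
    using card_pts_zsubst[OF GA_notin_zword[of k]] by simp
qed

text \<open>For \<open>b, c, d\<close> this is the weight \<open>na + nv v\<close> of the pair
  \<open>a v\<close>, simplified by the equation of \<open>eta\<close>.\<close>

fun zwt :: "ggen \<Rightarrow> real" where
  "zwt GA = 0"
| "zwt GB = 1"
| "zwt GC = eta"
| "zwt GD = eta ^ 2"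

definition znorm :: "ggen list \<Rightarrow> real" where
  "znorm w = sum_list (map zwt w)"

lemma znorm_simps [simp]: "znorm [] = 0" "znorm (s # w) = zwt s + znorm w"
    "znorm (u @ w) = znorm u + znorm w"
  by (simp_all add: znorm_def)

text \<open>The weights form an eigenvector of the substitution for the eigenvalue
  \<open>2 / eta\<close>; for \<open>b\<close> this is the equation of \<open>eta\<close>
  itself.\<close>

lemma znorm_zeta: "znorm (zeta s) = 2 / eta * zwt s"
proof -
  have "eta * (1 + eta ^ 2 + eta) = 2"
    using eta_root by (simp add: power2_eq_square power3_eq_cube algebra_simps)
  then have "1 + eta ^ 2 + eta = 2 / eta"
    using eta_pos by (simp add: field_simps)
  then show ?thesis
    by (cases s) (simp_all add: power2_eq_square)
qed

lemma znorm_zsubst: "znorm (zsubst w) = 2 / eta * znorm w"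
  by (induction w) (simp_all add: znorm_zeta add_divide_distrib distrib_left)

lemma znorm_zword: "znorm (zword k) = (2 / eta) ^ k"
  by (induction k) (simp_all add: znorm_zsubst)

lemma length_le_znorm: "GA \<notin> set w \<Longrightarrow> eta ^ 2 * real (length w) \<le> znorm w"
proof (induction w)
  case (Cons s w)
  have "eta ^ 2 \<le> zwt s"
    using Cons.prems eta_powers(2,6) by (cases s) auto
  then show ?case
    using Cons by (simp add: algebra_simps)
qed simp

lemma length_zword: "real (length (zword k)) \<le> (2 / eta) ^ k / eta ^ 2"
  using length_le_znorm[OF GA_notin_zword[of k]] eta_powers(5)
  by (simp add: znorm_zword field_simps)

text \<open>Independent choices from the ball of radius \<open>L\<close> at \<open>2^k\<close>
  visited points give distinct functions over one fixed \<Gamma>-component, each realized at the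
  stated cost.\<close>

lemma (in wreath_gen) card_ball_lower:
  "card (ball A S L) ^ 2 ^ k \<le> card (ball W SW (2 * length (zword k) + 2 ^ k * L))"
proof -
  let ?w = "awords (zword k)"
  have "2 ^ k \<le> card (pts ?w)"
    using card_pts_zword[of k] by linarith
  then obtain Y where Y: "Y \<subseteq> pts ?w" "card Y = 2 ^ k" "finite Y"
    by (rule obtain_subset_with_card_n)
  define \<phi> where "\<phi> h = ((\<lambda>x. if x \<in> Y then h x else \<one>), wact ?w)" for h :: "seq \<Rightarrow> 'a"
  have inj: "inj_on \<phi> (PiE Y (\<lambda>_. ball A S L))"
  proof (rule inj_onI)
    fix h h' assume h: "h \<in> PiE Y (\<lambda>_. ball A S L)" "h' \<in> PiE Y (\<lambda>_. ball A S L)" and eq: "\<phi> h = \<phi> h'"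
    show "h = h'"
    proof (rule PiE_ext[OF h])
      fix x assume "x \<in> Y"
      then show "h x = h' x"
        using fun_cong[OF arg_cong[OF eq, of fst], of x] by (simp add: \<phi>_def)
    qed
  qed
  have img: "\<phi> h \<in> ball W SW (2 * length (zword k) + 2 ^ k * L)" if h: "h \<in> PiE Y (\<lambda>_. ball A S L)" for h
  proof -
    let ?h = "\<lambda>x. if x \<in> Y then h x else \<one>"
    have hx: "h x \<in> carrier A" "len (h x) \<le> L" if "x \<in> Y" for x
      using PiE_mem[OF h that] by (simp_all add: in_ball_iff)
    have "(?h, wact ?w) \<in> ball W SW (length ?w + (\<Sum>x\<in>pts ?w. len (?h x)))"
      by (rule realize) (use hx Y(1) in auto)
    moreover have "(\<Sum>x\<in>pts ?w. len (?h x)) = (\<Sum>x\<in>Y. len (h x))"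
    proof -
      have "(\<Sum>x\<in>pts ?w. len (?h x)) = (\<Sum>x\<in>Y. len (?h x))"
        using Y(1) by (intro sum.mono_neutral_right) auto
      then show ?thesis
        by simp
    qed
    moreover have "(\<Sum>x\<in>Y. len (h x)) \<le> 2 ^ k * L"
      using sum_bounded_above[of Y "\<lambda>x. len (h x)" L] hx Y by simp
    ultimately show ?thesis
      unfolding \<phi>_def
      using ball_mono[of "length ?w + (\<Sum>x\<in>Y. len (h x))" "2 * length (zword k) + 2 ^ k * L" W SW]
      by auto
  qed
  have "card (PiE Y (\<lambda>_. ball A S L)) \<le> card (ball W SW (2 * length (zword k) + 2 ^ k * L))"
    by (rule card_inj_on_le[OF inj]) (use img in auto)
  then show ?thesis
    using Y by (simp add: card_PiE)
qed

subsection \<open>The exponents\<close>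

lemma two_over_eta: "2 / eta > 2"
  using eta_less_1 eta_pos by (simp add: field_simps)

lemma alpha_pos: "0 < alpha" and alpha_less_1: "alpha < 1"
  and powr_alpha: "(2 / eta) powr alpha = 2"
proof -
  have ln: "0 < ln (2::real)" "ln 2 < ln (2 / eta)"
    using ln_less_cancel_iff[of 2 "2 / eta"] two_over_eta by simp_all
  have "ln 2 / ln (2 / eta) < 1"
    by (subst divide_less_eq_1_pos) (use ln in linarith)+
  then show "alpha < 1"
    by (simp only: alpha_def)
  have "0 < ln 2 / ln (2 / eta)"
    by (rule divide_pos_pos) (use ln in linarith)+
  then show "0 < alpha"
    by (simp only: alpha_def)
  have "alpha * ln (2 / eta) = ln 2"
    unfolding alpha_def by (rule nonzero_eq_divide_eq[THEN iffD1]) (use ln in linarith, rule refl)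
  then show "(2 / eta) powr alpha = 2"
    by (simp add: powr_def del: ln_div)
qed

lemma power_powr: "x > 0 \<Longrightarrow> (x ^ k) powr a = (x powr a) ^ k" for x :: real
  by (simp add: powr_realpow[symmetric] powr_powr mult.commute)

lemma powr_one_minus_alpha: "(2 / eta) powr (1 - alpha) = 1 / eta"
  using two_over_eta by (simp add: powr_diff powr_alpha)

text \<open>With \<open>N = (2 / eta)^k\<close>, the definition of \<open>alpha\<close> says
  \<open>2^k = N^alpha\<close>, and therefore \<open>eta^-k = N^(1 - alpha)\<close>. This is the
  source of the map \<open>b -> alpha + (1 - alpha) * b\<close> on exponents.\<close>

lemma level_size:
  "2 ^ k * ((1 / eta) ^ k) powr b = ((2 / eta) ^ k) powr (alpha + (1 - alpha) * b)"
proof -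
  have X: "2 / eta > 0"
    using two_over_eta by simp
  have "(2::real) ^ k = ((2 / eta) ^ k) powr alpha"
    by (simp only: power_powr[OF X] powr_alpha)
  moreover have "(1 / eta) ^ k = ((2 / eta) ^ k) powr (1 - alpha)"
    by (simp only: power_powr[OF X] powr_one_minus_alpha)
  ultimately show ?thesis
    by (simp only: powr_powr powr_add)
qed

lemma ex_power_between:
  fixes x n :: real
  assumes "x > 1" "n \<ge> 1"
  shows "\<exists>k. x ^ k \<le> n \<and> n < x ^ Suc k"
proof -
  define K where "K = (LEAST k. n < x ^ k)"
  obtain k where "n < x ^ k"
    using real_arch_pow[OF assms(1)] by blast
  then have K: "n < x ^ K"
    unfolding K_def by (rule LeastI)
  have "K \<noteq> 0"
    using K assms(2) by (cases K) auto
  then obtain k where k: "K = Suc k"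
    by (cases K) auto
  have "\<not> n < x ^ k"
    using not_less_Least[of k "\<lambda>k. n < x ^ k"] k by (simp add: K_def)
  then show ?thesis
    using K k by (intro exI[of _ k]) auto
qed

text \<open>\<open>C\<close> rescales the radius and \<open>c\<close> the exponent;
  \<open>gequiv_exp\<close> later moves both into the argument.\<close>

definition lower_exp :: "('a, 'm) monoid_scheme \<Rightarrow> 'a set \<Rightarrow> real \<Rightarrow> bool" where
  "lower_exp G S b \<longleftrightarrow>
    (\<exists>c>0. \<exists>C::nat. \<forall>n\<ge>1. exp (c * real n powr b) \<le> real (card (ball G S (C * n))))"

lemma (in wreath_gen) lower_exp_W:
  assumes "lower_exp A S b" "b \<ge> 0"
  shows "lower_exp W SW (alpha + (1 - alpha) * b)"
proof -
  define q where "q = 2 / eta"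
  have q: "q > 2"
    unfolding q_def by (rule two_over_eta)
  let ?b = "alpha + (1 - alpha) * b"
  obtain c C where c: "c > 0" and C: "\<And>n. n \<ge> 1 \<Longrightarrow> exp (c * real n powr b) \<le> real (card (ball A S (C * n)))"
    using assms(1) by (auto simp: lower_exp_def)
  have b': "?b \<ge> 0"
    using assms(2) alpha_pos alpha_less_1 by simp
  \<comment> \<open>In units of \<open>q^k\<close>, the summand \<open>2 / eta^2\<close> pays for
    the word and \<open>2 * C\<close> for the values placed along it.\<close>
  obtain D :: nat where D: "2 / eta ^ 2 + 2 * real C \<le> real D"
    using real_arch_simple by blast
  have "exp (c * q powr (- ?b) * real n powr ?b) \<le> real (card (ball W SW (D * n)))" if n: "n \<ge> 1" for n :: nat
  proof -
    obtain k where k: "q ^ k \<le> real n" "real n < q ^ Suc k"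
    proof -
      have "q > 1" "real n \<ge> 1"
        using q n by simp_all
      from ex_power_between[OF this] show thesis
        using that by (elim exE conjE)
    qed
    \<comment> \<open>The length allotted to each point. Since \<open>eta^-k\<close> is at least 1,
      rounding up at most doubles it.\<close>
    define M where "M = nat \<lceil>(1 / eta) ^ k\<rceil>"
    have eta_k: "(1 / eta) ^ k \<ge> 1"
      by (rule one_le_power) simp
    then have M: "(1 / eta) ^ k \<le> real M" "real M \<le> 2 * (1 / eta) ^ k" "M \<ge> 1"
      unfolding M_def by linarith+
    have "c * q powr (- ?b) * real n powr ?b = c * (real n / q) powr ?b"
      using q by (simp add: powr_divide powr_minus_divide[of q ?b] del: minus_add_distrib)
    also have "\<dots> \<le> c * (q ^ k) powr ?b"
    proof -
      have "real n / q \<le> q ^ k"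
        using k(2) q by (simp add: field_simps)
      then show ?thesis
        using c b' q by (intro mult_left_mono powr_mono2) auto
    qed
    also have "\<dots> = c * (2 ^ k * ((1 / eta) ^ k) powr b)"
      by (simp only: level_size q_def)
    also have "\<dots> \<le> 2 ^ k * (c * real M powr b)"
    proof -
      have "((1 / eta) ^ k) powr b \<le> real M powr b"
        using M(1) assms(2) by (intro powr_mono2) auto
      then show ?thesis
        using c by simp
    qed
    finally have "exp (c * q powr (- ?b) * real n powr ?b) \<le> exp (2 ^ k * (c * real M powr b))"
      by simp
    also have "\<dots> = exp (c * real M powr b) ^ 2 ^ k"
      using exp_of_nat_mult[of "2 ^ k" "c * real M powr b"] by simp
    also have "\<dots> \<le> real (card (ball A S (C * M))) ^ 2 ^ k"
      by (rule power_mono[OF C[OF M(3)]]) simp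
    also have "\<dots> \<le> real (card (ball W SW (2 * length (zword k) + 2 ^ k * (C * M))))"
      using card_ball_lower[of "C * M" k] by (metis of_nat_le_iff of_nat_power)
    also have "\<dots> \<le> real (card (ball W SW (D * n)))"
    proof -
      have "real (2 * length (zword k) + 2 ^ k * (C * M)) \<le> 2 * (q ^ k / eta ^ 2) + 2 ^ k * (real C * (2 * (1 / eta) ^ k))"
        unfolding of_nat_add of_nat_mult of_nat_power of_nat_numeral
        by (intro add_mono mult_left_mono length_zword[folded q_def] M(2)) simp_all
      also have "\<dots> = (2 / eta ^ 2 + 2 * real C) * q ^ k"
        by (simp add: q_def power_divide field_simps)
      also have "\<dots> \<le> real D * real n"
        using D k(1) q by (intro mult_mono) simp_all
      finally have "2 * length (zword k) + 2 ^ k * (C * M) \<le> D * n"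
        by (simp only: of_nat_mult[symmetric] of_nat_le_iff)
      then show ?thesis
        using card_mono[OF WS.finite_ball ball_mono] by simp
    qed
    finally show ?thesis .
  qed
  moreover have "c * q powr (- ?b) > 0"
    using c q by (intro mult_pos_pos) simp_all
  ultimately show ?thesis
    unfolding lower_exp_def by blast
qed

subsection \<open>Counting lists by weight\<close>

lemma sum_lists_prod:
  fixes g :: "'b \<Rightarrow> real"
  assumes "finite B"
  shows "(\<Sum>xs\<in>{xs. set xs \<subseteq> B \<and> length xs = m}. prod_list (map g xs)) = (\<Sum>x\<in>B. g x) ^ m"
proof (induction m)
  case 0
  have "{xs. set xs \<subseteq> B \<and> length xs = 0} = {[]}"
    by auto
  then show ?case
    by simp
next
  case (Suc m)
  let ?L = "{xs. set xs \<subseteq> B \<and> length xs = m}"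
  have eq: "{xs. set xs \<subseteq> B \<and> length xs = Suc m} = (\<lambda>(x, xs). x # xs) ` (B \<times> ?L)"
    by (auto simp: length_Suc_conv)
  have "(\<Sum>xs\<in>{xs. set xs \<subseteq> B \<and> length xs = Suc m}. prod_list (map g xs))
      = (\<Sum>(x, xs)\<in>B \<times> ?L. g x * prod_list (map g xs))"
    unfolding eq by (subst sum.reindex) (auto simp: inj_on_def intro!: sum.cong)
  also have "\<dots> = (\<Sum>x\<in>B. g x) * (\<Sum>xs\<in>?L. prod_list (map g xs))"
    by (simp add: sum.cartesian_product[symmetric] sum_product)
  finally show ?case
    using Suc by simp
qed

text \<open>The exponential moment (Chernoff) bound: \<open>exp (r * (n - weight))\<close> is at
  least 1 on the counted lists, and its sum over all lists of length \<open>m\<close>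
  factorizes.\<close>

lemma card_lists_weight:
  fixes f :: "'b \<Rightarrow> nat"
  assumes "finite B" "r \<ge> 0"
  shows "real (card {xs. set xs \<subseteq> B \<and> length xs = m \<and> sum_list (map f xs) \<le> n})
    \<le> exp (r * real n) * (\<Sum>x\<in>B. exp (- r * real (f x))) ^ m"
proof -
  let ?L = "{xs. set xs \<subseteq> B \<and> length xs = m}" and ?M = "{xs. set xs \<subseteq> B \<and> length xs = m \<and> sum_list (map f xs) \<le> n}"
  let ?w = "\<lambda>xs. prod_list (map (\<lambda>x. exp (- r * real (f x))) xs)"
  have w: "?w xs = exp (- r * real (sum_list (map f xs)))" for xs
    by (induction xs) (simp_all add: exp_add[symmetric] algebra_simps)
  have fin: "finite ?L"
    using assms(1) by (rule finite_lists_length_eq)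
  have "real (card ?M) = (\<Sum>xs\<in>?M. 1)"
    by simp
  also have "\<dots> \<le> (\<Sum>xs\<in>?M. exp (r * real n) * ?w xs)"
  proof (rule sum_mono)
    fix xs assume "xs \<in> ?M"
    then have "r * real (sum_list (map f xs)) \<le> r * real n"
      using assms(2) by (intro mult_left_mono) simp_all
    then have "1 \<le> exp (r * real n + - r * real (sum_list (map f xs)))"
      by simp
    then show "1 \<le> exp (r * real n) * ?w xs"
      unfolding w exp_add .
  qed
  also have "\<dots> \<le> (\<Sum>xs\<in>?L. exp (r * real n) * ?w xs)"
    unfolding w using fin by (rule sum_mono2) auto
  also have "\<dots> = exp (r * real n) * (\<Sum>x\<in>B. exp (- r * real (f x))) ^ m"
    by (simp only: sum_distrib_left[symmetric] sum_lists_prod[OF assms(1)])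
  finally show ?thesis .
qed

text \<open>Flattens a list of normal forms into one list with \<open>None\<close> as terminator, so
  that only the total length matters, however unevenly it is distributed.\<close>

fun enc :: "('b \<times> 'b list) list \<Rightarrow> 'b option list" where
  "enc [] = []"
| "enc ((q, qs) # ps) = map Some (q # qs) @ None # enc ps"

lemma map_Some_None_inj:
  "map Some xs @ None # r = map Some ys @ None # t \<Longrightarrow> xs = ys \<and> r = t"
proof (induction xs arbitrary: ys)
  case Nil
  then show ?case
    by (cases ys) auto
next
  case (Cons x xs)
  then show ?case
    by (cases ys) auto
qed

text \<open>Knowing the number of blocks, decoding stops by itself and ignores the padding
  \<open>t\<close>, \<open>u\<close>.\<close>

lemma enc_inj: "length ps = length rs \<Longrightarrow> enc ps @ t = enc rs @ u \<Longrightarrow> ps = rs"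
proof (induction ps rs rule: list_induct2)
  case (Cons p ps r rs)
  obtain q qs q' qs' where "p = (q, qs)" "r = (q', qs')"
    by (cases p, cases r)
  then show ?case
    using Cons map_Some_None_inj[of "q # qs" "enc ps @ t" "q' # qs'" "enc rs @ u"] by auto
qed simp

lemma length_enc: "length (enc ps) = (\<Sum>p\<leftarrow>ps. 2 + length (snd p))"
  by (induction ps rule: enc.induct) auto

lemma set_enc: "set (enc ps) \<subseteq> insert None (Some ` (\<Union>p\<in>set ps. insert (fst p) (set (snd p))))"
  by (induction ps rule: enc.induct) auto

subsection \<open>Iterating the wreath recursion\<close>

text \<open>The initial letter lacks an \<open>a\<close> of its own; lending it one costs
  \<open>eta * na\<close>, at most \<open>na\<close>.\<close>

lemma tnorm_sec_unf: "tnorm (sec False (TV v s # awd qs)) + tnorm (sec True (TV v s # awd qs))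
    \<le> eta * tnorm (TV v s # awd qs) + na"
proof -
  have "eta * na \<le> na"
    using less_imp_le[OF na_pos] by (simp add: mult_left_le_one_le)
  moreover have "tnorm (awd qs) = qnorm qs"
    by (induction qs rule: awd.induct) auto
  then have "eta * tnorm (TV v s # awd qs) = eta * nv v + eta * qnorm qs"
    by (simp add: distrib_left)
  moreover have "nv (vph v) + (if vom v then na else 0) \<le> eta * na + eta * nv v"
    using nv_contraction[of v] by (simp only: distrib_left)
  moreover have "tnorm (sec False (TV v s # awd qs)) + tnorm (sec True (TV v s # awd qs))
      = nv (vph v) + (if vom v then na else 0) + (tnorm (sec False (awd qs)) + tnorm (sec True (awd qs)))"
    by simp
  moreover have "tnorm (sec False (awd qs)) + tnorm (sec True (awd qs)) \<le> eta * qnorm qs"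
    using tnorm_sec_awd[of False qs] by simp
  ultimately show ?thesis
    by linarith
qed

context wreath_gen
begin

definition dec :: "bool \<Rightarrow> (v4 \<times> 'a) \<times> (v4 \<times> 'a) list \<Rightarrow> (v4 \<times> 'a) \<times> (v4 \<times> 'a) list" where
  "dec b p = nf (sec b (unf p))"

fun leaves :: "nat \<Rightarrow> (v4 \<times> 'a) \<times> (v4 \<times> 'a) list \<Rightarrow> ((v4 \<times> 'a) \<times> (v4 \<times> 'a) list) list" where
  "leaves 0 p = [p]"
| "leaves (Suc k) p = leaves k (dec False p) @ leaves k (dec True p)"

text \<open>One bit for each of the \<open>2^k - 1\<close> inner vertices of the binary tree,
  telling whether its two subtrees stay in place.\<close>

fun signs :: "nat \<Rightarrow> (v4 \<times> 'a) \<times> (v4 \<times> 'a) list \<Rightarrow> bool list" where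
  "signs 0 p = []"
| "signs (Suc k) p = par True (unf p) # signs k (dec False p) @ signs k (dec True p)"

lemma length_leaves [simp]: "length (leaves k p) = 2 ^ k"
  by (induction k arbitrary: p) auto

lemma length_signs [simp]: "length (signs k p) = 2 ^ k - 1"
proof (induction k arbitrary: p)
  case (Suc k)
  obtain m :: nat where "2 ^ k = Suc m"
    using not0_implies_Suc[of "2 ^ k"] by auto
  then show ?case
    using Suc by simp
qed simp

lemma dec_toks: "p \<in> qtoks \<times> lists qtoks \<Longrightarrow> dec b p \<in> qtoks \<times> lists qtoks"
  unfolding dec_def by (intro nf_toks sec_toks unf_toks)

lemma leaves_toks: "p \<in> qtoks \<times> lists qtoks \<Longrightarrow> set (leaves k p) \<subseteq> qtoks \<times> lists qtoks"
proof (induction k arbitrary: p)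
  case (Suc k)
  show ?case
    using Suc.IH[OF dec_toks[OF Suc.prems, of False]] Suc.IH[OF dec_toks[OF Suc.prems, of True]] by simp
qed simp

lemma elem_dec: "p \<in> qtoks \<times> lists qtoks \<Longrightarrow> elem (unf (dec b p)) = elem (sec b (unf p))"
  unfolding dec_def by (intro elem_unf_nf sec_toks unf_toks)

text \<open>Passing to normal form changes the words at the vertices but not the elements they
  represent, so \<open>elem_eqI_sec\<close> applies at every vertex.\<close>

lemma elem_determined:
  assumes "p \<in> qtoks \<times> lists qtoks" "r \<in> qtoks \<times> lists qtoks"
    and "leaves k p = leaves k r" "signs k p = signs k r"
  shows "elem (unf p) = elem (unf r)"
  using assms
proof (induction k arbitrary: p r)
  case (Suc k)
  have "elem (unf (dec b p)) = elem (unf (dec b r))" for b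
    using Suc.prems(3,4)
    by (intro Suc.IH dec_toks Suc.prems(1,2)) (cases b; simp)+
  then have sec: "elem (sec b (unf p)) = elem (sec b (unf r))" for b
    using Suc.prems(1,2) by (simp add: elem_dec)
  have "par b (unf p) = par b (unf r)" for b
    using Suc.prems(4) par_neg[of True "unf p"] par_neg[of True "unf r"] by (cases b) simp_all
  then show ?case
    by (rule elem_eqI_sec[OF unf_toks[OF Suc.prems(1)] unf_toks[OF Suc.prems(2)] _ sec])
qed simp

lemma tnorm_dec: "tnorm (unf (dec False p)) + tnorm (unf (dec True p)) \<le> eta * tnorm (unf p) + na"
proof -
  obtain v s qs where p: "p = ((v, s), qs)"
    by (metis prod.exhaust)
  have "tnorm (unf (dec b p)) \<le> tnorm (sec b (unf p))" for b
    unfolding dec_def by (rule tnorm_unf_nf)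
  from this[of False] this[of True] show ?thesis
    using tnorm_sec_unf[of v s qs] by (simp add: p del: tnorm_Cons sec.simps)
qed

text \<open>Each inner vertex adds an error of at most \<open>na\<close>, which later levels can
  only shrink.\<close>

lemma tnorm_leaves:
  "(\<Sum>l\<leftarrow>leaves k p. tnorm (unf l)) \<le> eta ^ k * tnorm (unf p) + na * (2 ^ k - 1)"
proof (induction k arbitrary: p)
  case (Suc k)
  have "(\<Sum>l\<leftarrow>leaves (Suc k) p. tnorm (unf l))
      \<le> eta ^ k * (tnorm (unf (dec False p)) + tnorm (unf (dec True p))) + na * (2 ^ Suc k - 2)"
    using Suc[of "dec False p"] Suc[of "dec True p"] by (simp add: algebra_simps)
  also have "\<dots> \<le> eta ^ k * (eta * tnorm (unf p) + na) + na * (2 ^ Suc k - 2)"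
    by (intro add_right_mono mult_left_mono tnorm_dec) simp
  also have "\<dots> \<le> eta ^ Suc k * tnorm (unf p) + na * (2 ^ Suc k - 1)"
    using mult_right_mono[OF power_le_one[of eta k] less_imp_le[OF na_pos]] by (simp add: algebra_simps)
  finally show ?case .
qed simp

lemma length_le_tnorm: "na * real (length (snd p)) \<le> tnorm (unf p)"
proof -
  obtain v s qs where p: "p = ((v, s), qs)"
    by (metis prod.exhaust)
  show ?thesis
    using length_le_qnorm[of qs] nv_nonneg[of v] by (simp add: p tnorm_awd del: nv_nonneg)
qed

text \<open>Of the three units per leaf, two encode the initial letter and the terminator, and one
  bounds the error in \<open>tnorm_leaves\<close>.\<close>

lemma length_enc_leaves:
  "na * real (length (enc (leaves k p))) \<le> eta ^ k * tnorm (unf p) + 3 * na * 2 ^ k"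
proof -
  have "na * real (length (enc ps)) \<le> 2 * na * real (length ps) + (\<Sum>l\<leftarrow>ps. tnorm (unf l))" for ps
  proof (induction ps)
    case (Cons p ps)
    then show ?case
      using length_le_tnorm[of p] by (simp add: length_enc algebra_simps)
  qed simp
  from this[of "leaves k p"] show ?thesis
    using tnorm_leaves[of k p] na_pos by (simp add: algebra_simps del: na_pos)
qed

text \<open>The two sections read the word in opposite states, so each letter of \<open>A\<close>
  goes to exactly one of them.\<close>

lemma alen_sec: "alen (sec b w) + alen (sec (\<not> b) w) = alen w"
proof (induction w arbitrary: b)
  case (Cons t w)
  show ?case
    using Cons[of True] Cons[of False] by (cases t; cases b) auto
qed simp

lemma alen_unf_nf: "w \<in> lists toks \<Longrightarrow> alen (unf (nf w)) \<le> alen w"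
proof (induction w rule: nf.induct)
  case (2 w)
  then show ?case
    by (cases "nf w") auto
next
  case (3 v' s' w)
  then obtain v s qs where q: "nf w = ((v, s), qs)" "s \<in> carrier A"
    using nf_toks[of w] by (cases "nf w") auto
  then show ?case
    using 3 len_mult[of s' s] by auto
qed simp

lemma alen_leaves:
  "p \<in> qtoks \<times> lists qtoks \<Longrightarrow> (\<Sum>l\<leftarrow>leaves k p. alen (unf l)) \<le> alen (unf p)"
proof (induction k arbitrary: p)
  case (Suc k)
  have "alen (unf (dec b p)) \<le> alen (sec b (unf p))" for b
    unfolding dec_def by (intro alen_unf_nf sec_toks unf_toks Suc.prems)
  from this[of False] this[of True] show ?case
    using Suc.IH[OF dec_toks[OF Suc.prems, of False]] Suc.IH[OF dec_toks[OF Suc.prems, of True]]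
      alen_sec[of False "unf p"] by simp
qed simp

fun olen :: "(v4 \<times> 'a) option \<Rightarrow> nat" where
  "olen None = 0"
| "olen (Some q) = len (snd q)"

lemma alen_unf: "alen (unf p) = len (snd (fst p)) + (\<Sum>q\<leftarrow>snd p. len (snd q))"
proof -
  have "alen (awd qs) = (\<Sum>q\<leftarrow>qs. len (snd q))" for qs
    by (induction qs rule: awd.induct) auto
  then show ?thesis
    by (cases p rule: unf.cases) simp
qed

lemma olen_enc: "(\<Sum>x\<leftarrow>enc ps. olen x) = (\<Sum>l\<leftarrow>ps. alen (unf l))"
proof (induction ps rule: enc.induct)
  case (2 q qs ps)
  have "(\<Sum>x\<leftarrow>map Some qs. olen x) = (\<Sum>q\<leftarrow>qs. len (snd q))"
    by (induction qs) auto
  then show ?case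
    using 2 by (simp add: alen_unf o_def)
qed simp

lemma member_le_sum_list_olen: "x \<in> set xs \<Longrightarrow> olen x \<le> (\<Sum>x\<leftarrow>xs. olen x)"
  by (rule member_le_sum_list) auto

text \<open>The ball embeds into pairs of a sign list and a coded list of length \<open>R\<close>,
  and \<open>card_lists_weight\<close> counts the latter. In the sum over letters,
  \<open>None\<close> gives 1 and each \<open>s\<close> occurs with four elements of the
  four-group.\<close>

lemma card_ball_upper:
  assumes r: "r \<ge> 0" and R: "eta ^ k * real n + 3 * na * 2 ^ k \<le> na * real R"
  shows "real (card (ball W SW n))
    \<le> 2 ^ 2 ^ k * (exp (r * real n) * (1 + 4 * (\<Sum>s\<in>ball A S n. exp (- r * real (len s)))) ^ R)"
proof -
  define B where "B = insert None (Some ` ((UNIV :: v4 set) \<times> ball A S n))"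
  have finB: "finite B"
    by (simp add: B_def)
  define good where "good g p \<longleftrightarrow> p \<in> qtoks \<times> lists qtoks \<and> elem (unf p) = g
    \<and> tnorm (unf p) \<le> real n \<and> alen (unf p) \<le> n" for g p
  have ex: "\<exists>p. good g p" if g: "g \<in> ball W SW n" for g
  proof -
    obtain w where w: "w \<in> lists toks" "g = elem w" "tnorm w \<le> real n" "alen w \<le> n"
      using ball_word[OF g] by (elim exE conjE)
    have "good g (nf w)"
      unfolding good_def using w nf_toks[OF w(1)] elem_unf_nf[OF w(1)]
        order_trans[OF tnorm_unf_nf[of w] w(3)] order_trans[OF alen_unf_nf[OF w(1)] w(4)] by simp
    then show ?thesis
      by (rule exI)
  qed
  define P where "P g = (SOME p. good g p)" for g
  have P: "good g (P g)" if "g \<in> ball W SW n" for g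
    unfolding P_def by (rule someI_ex[OF ex[OF that]])
  \<comment> \<open>Padding with \<open>None\<close> gives all codes the length \<open>R\<close>
    without using any of the length budget.\<close>
  define code where "code g = (signs k (P g),
    enc (leaves k (P g)) @ replicate (R - length (enc (leaves k (P g)))) None)" for g
  have inj: "inj_on code (ball W SW n)"
  proof (rule inj_onI)
    fix g h assume g: "g \<in> ball W SW n" and h: "h \<in> ball W SW n" and eq: "code g = code h"
    have "enc (leaves k (P g)) @ replicate (R - length (enc (leaves k (P g)))) None
        = enc (leaves k (P h)) @ replicate (R - length (enc (leaves k (P h)))) None"
      using eq by (simp add: code_def)
    then have "leaves k (P g) = leaves k (P h)"
      by (rule enc_inj[rotated]) simp
    moreover have "signs k (P g) = signs k (P h)"
      using eq by (simp add: code_def)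
    ultimately have "elem (unf (P g)) = elem (unf (P h))"
      using P[OF g] P[OF h] by (intro elem_determined) (simp_all add: good_def)
    then show "g = h"
      using P[OF g] P[OF h] by (simp add: good_def)
  qed
  let ?X = "{bs :: bool list. set bs \<subseteq> UNIV \<and> length bs = 2 ^ k - 1}"
  let ?Y = "{xs. set xs \<subseteq> B \<and> length xs = R \<and> (\<Sum>x\<leftarrow>xs. olen x) \<le> n}"
  have img: "code g \<in> ?X \<times> ?Y" if g: "g \<in> ball W SW n" for g
  proof -
    let ?e = "enc (leaves k (P g))"
    have pg: "P g \<in> qtoks \<times> lists qtoks" "tnorm (unf (P g)) \<le> real n" "alen (unf (P g)) \<le> n"
      using P[OF g] by (simp_all add: good_def)
    have "na * real (length ?e) \<le> eta ^ k * tnorm (unf (P g)) + 3 * na * 2 ^ k"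
      by (rule length_enc_leaves)
    also have "\<dots> \<le> eta ^ k * real n + 3 * na * 2 ^ k"
      using pg(2) by (intro add_right_mono mult_left_mono) simp_all
    also note R
    finally have len: "length ?e \<le> R"
      by simp
    have olen: "(\<Sum>x\<leftarrow>?e. olen x) \<le> n"
      using olen_enc alen_leaves[OF pg(1), of k] pg(3) by simp
    have "set ?e \<subseteq> B"
    proof
      fix x assume x: "x \<in> set ?e"
      show "x \<in> B"
      proof (cases x)
        case (Some q)
        then have "q \<in> (\<Union>p\<in>set (leaves k (P g)). insert (fst p) (set (snd p)))"
          using set_enc[of "leaves k (P g)"] x by auto
        then have "q \<in> qtoks"
          using leaves_toks[OF pg(1), of k] by auto
        moreover have "len (snd q) \<le> n"
          using member_le_sum_list_olen[OF x] olen Some by simp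
        ultimately show ?thesis
          by (cases q) (simp add: Some B_def in_ball_iff)
      qed (simp add: B_def)
    qed
    then show ?thesis
      using len olen by (auto simp: code_def B_def sum_list_replicate)
  qed
  have "finite ?Y"
    using finite_lists_length_eq[OF finB, of R] by (rule rev_finite_subset) auto
  then have "card (ball W SW n) \<le> card (?X \<times> ?Y)"
    by (intro card_inj_on_le[OF inj image_subsetI[OF img]] finite_cartesian_product
        finite_lists_length_eq finite_UNIV)
  also have "\<dots> = 2 ^ (2 ^ k - 1) * card ?Y"
    unfolding card_cartesian_product card_lists_length_eq[OF finite_UNIV] by simp
  finally have "real (card (ball W SW n)) \<le> 2 ^ (2 ^ k - 1) * real (card ?Y)"
    by (simp only: of_nat_le_iff[symmetric, where 'a = real] of_nat_mult of_nat_power of_nat_numeral)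
  also have "\<dots> \<le> 2 ^ 2 ^ k * (exp (r * real n) * (\<Sum>x\<in>B. exp (- r * real (olen x))) ^ R)"
    by (intro mult_mono power_increasing card_lists_weight[OF finB r]) simp_all
  also have "(\<Sum>x\<in>B. exp (- r * real (olen x))) = 1 + 4 * (\<Sum>s\<in>ball A S n. exp (- r * real (len s)))"
  proof -
    have "(\<Sum>x\<in>B. exp (- r * real (olen x)))
        = 1 + (\<Sum>x\<in>Some ` ((UNIV :: v4 set) \<times> ball A S n). exp (- r * real (olen x)))"
      unfolding B_def by (subst sum.insert) auto
    also have "(\<Sum>x\<in>Some ` ((UNIV :: v4 set) \<times> ball A S n). exp (- r * real (olen x)))
        = (\<Sum>x\<in>(UNIV :: v4 set) \<times> ball A S n. exp (- r * real (len (snd x))))"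
      by (subst sum.reindex) simp_all
    also have "\<dots> = (\<Sum>v\<in>(UNIV :: v4 set). \<Sum>s\<in>ball A S n. exp (- r * real (len s)))"
      by (simp only: sum.cartesian_product split_def)
    also have "\<dots> = 4 * (\<Sum>s\<in>ball A S n. exp (- r * real (len s)))"
      by (simp add: card_v4)
    finally show ?thesis .
  qed
  finally show ?thesis .
qed

end

subsection \<open>Upper bounds for the growth\<close>

definition upper_exp :: "('a, 'm) monoid_scheme \<Rightarrow> 'a set \<Rightarrow> real \<Rightarrow> bool" where
  "upper_exp G S b \<longleftrightarrow>
    (\<exists>C\<ge>0. \<forall>n\<ge>1. real (card (ball G S n)) \<le> exp (C * real n powr b))"

context gen_group
begin

text \<open>The form of the growth bound which passes to the wreath product: there, \<open>L\<close> is the average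
  length available at each of the roughly \<open>n / L\<close> points.\<close>
definition upper_sum :: "real \<Rightarrow> bool" where
  "upper_sum b \<longleftrightarrow> (\<exists>C\<ge>0. \<forall>L\<ge>1. \<forall>n.
    (\<Sum>g\<in>ball G S n. exp (- (C * L powr (b - 1)) * real (len g))) \<le> exp (C * L powr b))"

text \<open>Beyond \<open>L\<close>, concavity gives \<open>l^b <= L^(b-1) * l\<close>; so a rate
  \<open>D * L^(b-1)\<close> cancels the growth of spheres up to \<open>exp (D * L^b)\<close>, and
  any additional rate leaves a geometric series.\<close>

lemma upper_sumI:
  assumes "upper_exp G S b" "0 < b" "b \<le> 1"
  shows "upper_sum b"
proof -
  obtain D where D: "D \<ge> 0" and upper: "\<And>n. n \<ge> 1 \<Longrightarrow> real (card (ball G S n)) \<le> exp (D * real n powr b)"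
    using assms(1) by (auto simp: upper_exp_def)
  have "ball G S 0 = {\<one>}"
    by (auto simp: ball_def)
  then have card: "real (card (ball G S n)) \<le> exp (D * real n powr b)" for n
    using upper[of n] by (cases "n = 0") auto
  \<comment> \<open>\<open>D\<close> cancels the growth and 1 supplies the decay of the geometric
    series, whose sum costs \<open>1 + 1 / b\<close> in the exponent.\<close>
  define C where "C = D + 1 + 1 / b"
  have C: "C \<ge> D + 1" "C \<ge> 0"
    using D assms(2) by (simp_all add: C_def)
  have "(\<Sum>g\<in>ball G S n. exp (- (C * L powr (b - 1)) * real (len g))) \<le> exp (C * L powr b)"
    if L: "L \<ge> 1" for L n
  proof -
    define m where "m = L powr (b - 1)"
    have m: "0 < m" "m \<le> 1"
      using L assms(3) powr_mono[of "b - 1" 0 L] by (simp_all add: m_def)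
    have Lb: "L powr b \<ge> 1"
      using L assms(2) by (simp add: ge_one_powr_ge_zero)
    have conc: "real l powr b \<le> L powr b + m * real l" for l :: nat
    proof (cases "real l \<le> L")
      case True
      then have "real l powr b \<le> L powr b"
        using assms(2) by (intro powr_mono2) simp_all
      moreover have "0 \<le> m * real l"
        using m by simp
      ultimately show ?thesis
        by linarith
    next
      case False
      then have "real l powr (b - 1) \<le> m"
        unfolding m_def using L assms(3) by (intro powr_mono2') simp_all
      then have "real l powr (b - 1) * real l \<le> m * real l"
        by (rule mult_right_mono) simp
      moreover have "real l powr (b - 1) * real l = real l powr b"
        using False L by (simp add: powr_mult_base mult.commute)
      ultimately show ?thesis
        using Lb by linarith
    qed
    have exp_m: "exp (- m) < 1"
      using m by simp
    have geo: "(\<Sum>l\<le>n. exp (- m) ^ l) \<le> exp ((1 + 1 / b) * L powr b)"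
    proof -
      have "(1 - exp (- m)) * (\<Sum>l\<le>n. exp (- m) ^ l) \<le> 1"
        unfolding sum_gp_basic by simp
      moreover have "1 - exp (- m) \<ge> m / (1 + m)"
      proof -
        have "exp (- m) \<le> 1 / (1 + m)"
          unfolding exp_minus inverse_eq_divide
          using m exp_ge_add_one_self[of m] by (intro divide_left_mono mult_pos_pos) (auto intro: add_pos_pos)
        then show ?thesis
          using m by (simp add: field_simps)
      qed
      moreover have "(\<Sum>l\<le>n. exp (- m) ^ l) \<ge> 0"
        by (intro sum_nonneg) simp
      ultimately have "m / (1 + m) * (\<Sum>l\<le>n. exp (- m) ^ l) \<le> 1"
        by (meson mult_right_mono order_trans)
      then have "(\<Sum>l\<le>n. exp (- m) ^ l) \<le> (1 + m) / m"
        using m by (simp add: field_simps)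
      also have "\<dots> \<le> 2 / m"
        using m by (simp add: field_simps)
      also have "\<dots> = 2 * L powr (1 - b)"
        using powr_minus_divide[of L "b - 1"] by (simp add: m_def)
      \<comment> \<open>A power of \<open>L\<close> is absorbed here:
        \<open>L = (L^b)^(1/b)\<close>, which requires \<open>b > 0\<close>.\<close>
      also have "\<dots> \<le> exp (L powr b) * exp (1 / b * L powr b)"
      proof (rule mult_mono)
        show "2 \<le> exp (L powr b)"
          using exp_ge_add_one_self[of "L powr b"] Lb by linarith
        have "L powr (1 - b) \<le> L powr 1"
          using L assms(2) by (intro powr_mono) simp_all
        also have "L powr 1 = (L powr b) powr (1 / b)"
          using assms(2) by (simp add: powr_powr)
        also have "\<dots> \<le> exp (L powr b) powr (1 / b)"
        proof (rule powr_mono2)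
          show "L powr b \<le> exp (L powr b)"
            using exp_ge_add_one_self[of "L powr b"] by linarith
        qed (use assms(2) in simp_all)
        also have "\<dots> = exp (1 / b * L powr b)"
          by (simp add: powr_def)
        finally show "L powr (1 - b) \<le> exp (1 / b * L powr b)" .
      qed simp_all
      also have "\<dots> = exp ((1 + 1 / b) * L powr b)"
        by (simp add: exp_add[symmetric] algebra_simps)
      finally show ?thesis .
    qed
    have "(\<Sum>g\<in>ball G S n. exp (- (C * m) * real (len g)))
        = (\<Sum>l\<le>n. \<Sum>g\<in>{g \<in> ball G S n. len g = l}. exp (- (C * m) * real (len g)))"
      by (rule sum.group[symmetric]) (auto simp: in_ball_iff)
    also have "\<dots> \<le> (\<Sum>l\<le>n. exp (D * L powr b) * exp (- m) ^ l)"
    proof (rule sum_mono)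
      fix l
      have "(\<Sum>g\<in>{g \<in> ball G S n. len g = l}. exp (- (C * m) * real (len g)))
          = real (card {g \<in> ball G S n. len g = l}) * exp (- (C * m) * real l)"
        by simp
      also have "\<dots> \<le> exp (D * real l powr b) * exp (- (C * m) * real l)"
      proof (rule mult_right_mono)
        have "card {g \<in> ball G S n. len g = l} \<le> card (ball G S l)"
          by (rule card_mono) (auto simp: in_ball_iff)
        then show "real (card {g \<in> ball G S n. len g = l}) \<le> exp (D * real l powr b)"
          using card[of l] by linarith
      qed simp
      also have "\<dots> \<le> exp (D * (L powr b + m * real l)) * exp (- ((D + 1) * m) * real l)"
      proof (rule mult_mono)
        show "exp (D * real l powr b) \<le> exp (D * (L powr b + m * real l))"
          using conc[of l] D by (simp add: mult_left_mono)
        have "(D + 1) * m * real l \<le> C * m * real l"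
          using C m by (intro mult_right_mono) simp_all
        then show "exp (- (C * m) * real l) \<le> exp (- ((D + 1) * m) * real l)"
          by simp
      qed simp_all
      also have "\<dots> = exp (D * L powr b) * exp (- m) ^ l"
        by (simp add: exp_of_nat_mult[symmetric] exp_add[symmetric] algebra_simps)
      finally show "(\<Sum>g\<in>{g \<in> ball G S n. len g = l}. exp (- (C * m) * real (len g)))
          \<le> exp (D * L powr b) * exp (- m) ^ l" .
    qed
    also have "\<dots> = exp (D * L powr b) * (\<Sum>l\<le>n. exp (- m) ^ l)"
      by (simp only: sum_distrib_left)
    also have "\<dots> \<le> exp (D * L powr b) * exp ((1 + 1 / b) * L powr b)"
      by (rule mult_left_mono[OF geo]) simp
    also have "\<dots> = exp (C * L powr b)"
      by (simp add: exp_add[symmetric] C_def algebra_simps)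
    finally show ?thesis
      by (simp only: m_def)
  qed
  then show ?thesis
    unfolding upper_sum_def using C(2) by blast
qed

end

text \<open>At depth \<open>k\<close> with \<open>(2 / eta)^k\<close> comparable to
  \<open>n\<close>, every factor of \<open>card_ball_upper\<close> is the exponential of a multiple
  of \<open>2^k * L^b\<close>, where \<open>L = eta^-k\<close>; \<open>level_size\<close> turns this
  into the new exponent.\<close>

lemma (in wreath_gen) upper_exp_W:
  assumes "upper_sum b" "0 \<le> b"
  shows "upper_exp W SW (alpha + (1 - alpha) * b)"
proof -
  define q where "q = 2 / eta"
  have q: "q > 2"
    unfolding q_def by (rule two_over_eta)
  let ?b = "alpha + (1 - alpha) * b"
  have b': "?b \<ge> 0"
    using assms(2) alpha_pos alpha_less_1 by simp
  obtain C where C: "C \<ge> 0" and upper: "\<And>L n. L \<ge> 1 \<Longrightarrow>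
      (\<Sum>g\<in>ball A S n. exp (- (C * L powr (b - 1)) * real (len g))) \<le> exp (C * L powr b)"
    using assms(1) by (auto simp: upper_sum_def)
  obtain D :: nat where D: "1 / na \<le> real D"
    using real_arch_simple by blast
  \<comment> \<open>The summands bound the signs, the factor \<open>exp (r * n)\<close>, and the
    \<open>(3 + D) * 2^k\<close> letters.\<close>
  define E where "E = 1 + C + (2 + C) * (3 + real D)"
  have E: "E \<ge> 0"
    using C by (simp add: E_def)
  have "real (card (ball W SW n)) \<le> exp (E * q powr ?b * real n powr ?b)" if n: "n \<ge> 1" for n :: nat
  proof -
    have "q > 1" "real n \<ge> 1"
      using q n by simp_all
    from ex_power_between[OF this] obtain j where j: "q ^ j \<le> real n" "real n < q ^ Suc j"
      by (elim exE conjE)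
    \<comment> \<open>One level deeper than \<open>j\<close>, so that \<open>n <= q^k\<close>: the
      contracted weight \<open>eta^k * n\<close> is then at most \<open>2^k\<close>.\<close>
    define k where "k = Suc j"
    have k: "real n \<le> q ^ k" "q ^ k \<le> q * real n"
      using j q by (simp_all add: k_def mult_left_mono)
    define L where "L = (1 / eta) ^ k"
    have L: "L \<ge> 1"
      unfolding L_def by (rule one_le_power) simp
    have Lb: "L powr b \<ge> 1"
      using L assms(2) by (simp add: ge_one_powr_ge_zero)
    have qk: "q ^ k = 2 ^ k * L"
      by (simp add: q_def L_def power_divide)
    define r where "r = C * L powr (b - 1)"
    have r: "r \<ge> 0"
      using C by (simp add: r_def)
    define R where "R = (3 + D) * 2 ^ k"
    have R: "eta ^ k * real n + 3 * na * 2 ^ k \<le> na * real R"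
    proof -
      have "eta ^ k * real n \<le> eta ^ k * q ^ k"
        using k(1) by (rule mult_left_mono) simp
      also have "\<dots> = 2 ^ k"
        by (simp add: q_def power_divide)
      also have "\<dots> \<le> na * real D * 2 ^ k"
        using D na_pos by (simp add: field_simps)
      finally show ?thesis
        by (simp add: R_def algebra_simps)
    qed
    have rn: "r * real n \<le> C * (2 ^ k * L powr b)"
    proof -
      have "r * real n \<le> r * (2 ^ k * L)"
        using k(1) r unfolding qk by (rule mult_left_mono)
      also have "\<dots> = C * (2 ^ k * (L * L powr (b - 1)))"
        by (simp add: r_def)
      also have "L * L powr (b - 1) = L powr b"
        using L powr_mult_base[of L "b - 1"] by simp
      finally show ?thesis .
    qed
    have Z: "1 + 4 * (\<Sum>s\<in>ball A S n. exp (- r * real (len s))) \<le> exp ((2 + C) * L powr b)"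
    proof -
      have "1 + 4 * (\<Sum>s\<in>ball A S n. exp (- r * real (len s))) \<le> 1 + 4 * exp (C * L powr b)"
        using upper[OF L, of n] by (simp add: r_def)
      also have "\<dots> \<le> 5 * exp (C * L powr b)"
        using C by simp
      also have "\<dots> \<le> exp (2 * L powr b) * exp (C * L powr b)"
      proof (rule mult_right_mono)
        have "(5::real) \<le> exp 2"
          using exp_lower_Taylor_quadratic[of "2::real"] by simp
        also have "exp 2 \<le> exp (2 * L powr b)"
          using Lb by simp
        finally show "5 \<le> exp (2 * L powr b)" .
      qed simp
      also have "\<dots> = exp ((2 + C) * L powr b)"
        by (simp add: exp_add[symmetric] algebra_simps)
      finally show ?thesis .
    qed
    have "(2::real) ^ 2 ^ k \<le> exp 1 ^ 2 ^ k"
      using exp_ge_add_one_self[of "1::real"] by (intro power_mono) simp_all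
    also have "\<dots> = exp (2 ^ k)"
      using exp_of_nat_mult[of "2 ^ k" "1::real"] by simp
    also have "\<dots> \<le> exp (2 ^ k * L powr b)"
      using Lb by simp
    finally have two: "(2::real) ^ 2 ^ k \<le> exp (2 ^ k * L powr b)" .
    have nonneg: "0 \<le> 1 + 4 * (\<Sum>s\<in>ball A S n. exp (- r * real (len s)))"
      by (intro add_nonneg_nonneg mult_nonneg_nonneg sum_nonneg) simp_all
    have "real (card (ball W SW n))
        \<le> 2 ^ 2 ^ k * (exp (r * real n) * (1 + 4 * (\<Sum>s\<in>ball A S n. exp (- r * real (len s)))) ^ R)"
      by (rule card_ball_upper[OF r R])
    also have "\<dots> \<le> exp (2 ^ k * L powr b) * (exp (C * (2 ^ k * L powr b)) * exp ((2 + C) * L powr b) ^ R)"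
      using two rn Z nonneg by (intro mult_mono power_mono) simp_all
    also have "exp ((2 + C) * L powr b) ^ R = exp ((2 + C) * (3 + real D) * (2 ^ k * L powr b))"
      by (simp add: exp_of_nat_mult[symmetric] R_def algebra_simps)
    also have "exp (2 ^ k * L powr b) * (exp (C * (2 ^ k * L powr b)) * \<dots>) = exp (E * (2 ^ k * L powr b))"
      by (simp add: exp_add[symmetric] E_def algebra_simps)
    also have "2 ^ k * L powr b = (q ^ k) powr ?b"
      unfolding L_def q_def by (rule level_size)
    also have "exp (E * (q ^ k) powr ?b) \<le> exp (E * (q * real n) powr ?b)"
      using E k(2) q b' by (simp add: mult_left_mono powr_mono2)
    also have "\<dots> = exp (E * q powr ?b * real n powr ?b)"
      using q by (simp add: powr_mult)
    finally show ?thesis .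
  qed
  moreover have "E * q powr ?b \<ge> 0"
    using E by simp
  ultimately show ?thesis
    unfolding upper_exp_def by blast
qed

subsection \<open>Change of generating set and of group\<close>

lemma ball_subset_ball:
  assumes "gen_group G S" "gen_group G T"
  shows "\<exists>D>0. \<forall>n. card (ball G S n) \<le> card (ball G T (D * n))"
proof -
  interpret S: gen_group G S by fact
  interpret T: gen_group G T by fact
  let ?s = "S \<union> (\<lambda>s. inv\<^bsub>G\<^esub> s) ` S"
  define D where "D = 1 + (\<Sum>s\<in>?s. T.len s)"
  have s: "s \<in> ball G T D" if "s \<in> ?s" for s
    using that S.sym_carrier S.finite_sym member_le_sum[of s ?s T.len]
    by (auto simp: T.in_ball_iff D_def)
  have "ball G S n \<subseteq> ball G T (D * n)" for n
  proof
    fix g assume "g \<in> ball G S n"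
    then show "g \<in> ball G T (D * n)"
    proof (induction rule: ball_ind)
      case (mult s g n)
      then have "s \<otimes>\<^bsub>G\<^esub> g \<in> ball G T (D + D * n)"
        by (intro T.mult_in_ball s) simp_all
      then show ?case
        by simp
    qed simp
  qed
  then have "card (ball G S n) \<le> card (ball G T (D * n))" for n
    by (rule card_mono[OF T.finite_ball])
  moreover have "D > 0"
    by (simp add: D_def)
  ultimately show ?thesis
    by blast
qed

text \<open>As \<open>b > 0\<close>, a constant factor in the exponent becomes one in the argument:
  \<open>C * n^b = (C^(1/b) * n)^b\<close>.\<close>

lemma gequiv_exp:
  assumes S: "gen_group G S" and T: "gen_group G T"
    and "upper_exp G S b" "lower_exp G S b" "b > 0"
  shows "gequiv (growth G T) (\<lambda>n. exp (real n powr b))"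
  unfolding gequiv_def
proof
  obtain C where C: "C \<ge> 0" "\<And>n. n \<ge> 1 \<Longrightarrow> real (card (ball G S n)) \<le> exp (C * real n powr b)"
    using assms(3) by (auto simp: upper_exp_def)
  obtain D where D: "D > 0" "\<And>n. card (ball G T n) \<le> card (ball G S (D * n))"
    using ball_subset_ball[OF T S] by auto
  obtain K :: nat where K: "C powr (1 / b) * real D \<le> real K"
    using real_arch_simple by blast
  have "growth G T n \<le> exp (real (Suc K * n) powr b)" if n: "n \<ge> 1" for n
  proof -
    have "growth G T n \<le> real (card (ball G S (D * n)))"
      unfolding growth_eq_card_ball using D(2) by simp
    also have "\<dots> \<le> exp (C * real (D * n) powr b)"
      using D(1) n by (intro C(2)) simp
    also have "C * real (D * n) powr b = (C powr (1 / b) * real D * real n) powr b"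
      using C(1) assms(5) by (simp add: powr_mult powr_powr)
    also have "\<dots> \<le> real (Suc K * n) powr b"
    proof (rule powr_mono2)
      have "C powr (1 / b) * real D \<le> real (Suc K)"
        using K by simp
      then have "C powr (1 / b) * real D * real n \<le> real (Suc K) * real n"
        by (rule mult_right_mono) simp
      then show "C powr (1 / b) * real D * real n \<le> real (Suc K * n)"
        by (simp only: of_nat_mult)
    qed (use assms(5) in simp_all)
    finally show ?thesis
      by simp
  qed
  then show "gpreceq (growth G T) (\<lambda>n. exp (real n powr b))"
    unfolding gpreceq_def by (intro exI[of _ "Suc K"] conjI eventually_sequentiallyI[of 1]) auto
next
  obtain c C where c: "c > 0" "\<And>n. n \<ge> 1 \<Longrightarrow> exp (c * real n powr b) \<le> real (card (ball G S (C * n)))"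
    using assms(4) by (auto simp: lower_exp_def)
  obtain D where D: "D > 0" "\<And>n. card (ball G S n) \<le> card (ball G T (D * n))"
    using ball_subset_ball[OF S T] by auto
  interpret T: gen_group G T by fact
  obtain M :: nat where "(1 / c) powr (1 / b) \<le> real M"
    using real_arch_simple by blast
  then have M: "(1 / c) powr (1 / b) \<le> real (Suc M)"
    by simp
  \<comment> \<open>The added 1 keeps the factor positive even when \<open>C = 0\<close>.\<close>
  let ?K = "D * C * Suc M + 1"
  have "exp (real n powr b) \<le> growth G T (?K * n)" if n: "n \<ge> 1" for n
  proof -
    have "1 = c * ((1 / c) powr (1 / b)) powr b"
      using c(1) assms(5) by (simp add: powr_powr)
    also have "\<dots> \<le> c * real (Suc M) powr b"
      using c(1) assms(5) M by (intro mult_left_mono powr_mono2) simp_all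
    finally have "1 * real n powr b \<le> c * real (Suc M) powr b * real n powr b"
      by (rule mult_right_mono) simp
    then have "real n powr b \<le> c * real (Suc M * n) powr b"
      by (simp add: powr_mult mult.assoc del: of_nat_Suc mult_Suc)
    then have "exp (real n powr b) \<le> exp (c * real (Suc M * n) powr b)"
      by simp
    also have "\<dots> \<le> real (card (ball G S (C * (Suc M * n))))"
      using n by (intro c(2)) simp
    also have "\<dots> \<le> real (card (ball G T (D * (C * (Suc M * n)))))"
      using D(2) by simp
    also have "\<dots> \<le> real (card (ball G T (?K * n)))"
    proof -
      have "D * (C * (Suc M * n)) \<le> ?K * n"
        by (simp add: algebra_simps)
      from card_mono[OF T.finite_ball ball_mono[OF this]] show ?thesis
        by (simp only: of_nat_le_iff)
    qed
    finally show ?thesis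
      by (simp only: growth_eq_card_ball)
  qed
  then show "gpreceq (\<lambda>n. exp (real n powr b)) (growth G T)"
    unfolding gpreceq_def by (intro exI[of _ ?K] conjI eventually_sequentiallyI[of 1]) auto
qed

lemma infinite_carrier:
  assumes "gen_group G S" "lower_exp G S b" "b > 0"
  shows "infinite (carrier G)"
proof
  interpret gen_group G S by fact
  assume fin: "finite (carrier G)"
  obtain c C where c: "c > 0" "\<And>n. n \<ge> 1 \<Longrightarrow> exp (c * real n powr b) \<le> real (card (ball G S (C * n)))"
    using assms(2) by (auto simp: lower_exp_def)
  let ?N = "real (card (carrier G))"
  obtain n :: nat where "(?N / c) powr (1 / b) \<le> real n"
    using real_arch_simple by blast
  then have n: "(?N / c) powr (1 / b) \<le> real (Suc n)"
    by simp
  have "?N = c * ((?N / c) powr (1 / b)) powr b"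
    using c(1) assms(3) by (simp add: powr_powr)
  also have "\<dots> \<le> c * real (Suc n) powr b"
    using c(1) assms(3) n by (intro mult_left_mono powr_mono2) simp_all
  also have "\<dots> < exp (c * real (Suc n) powr b)"
    using exp_ge_add_one_self[of "c * real (Suc n) powr b"] by linarith
  also have "\<dots> \<le> real (card (ball G S (C * Suc n)))"
    by (rule c(2)) simp
  also have "\<dots> \<le> ?N"
    using card_mono[OF fin ball_carrier] by simp
  finally show False
    by simp
qed

section \<open>Copies of a group along an injection\<close>

locale transported = group G for G :: "'a monoid" (structure) +
  fixes h :: "'a \<Rightarrow> 'b" and h' :: "'b \<Rightarrow> 'a"
  assumes left_inverse: "\<And>x. h' (h x) = x"
begin

definition "T = transport h h' G"

lemma T_simps: "carrier T = h ` carrier G" "\<one>\<^bsub>T\<^esub> = h \<one>" "h x \<otimes>\<^bsub>T\<^esub> h y = h (x \<otimes> y)"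
  by (simp_all add: T_def transport_def left_inverse)

lemma inj_h: "inj h"
  by (metis injI left_inverse)

lemma group_T: "group T"
proof -
  have "h \<in> hom G T"
    by (auto simp: hom_def T_simps)
  then have "group (T \<lparr>carrier := h ` carrier G, one := h \<one>\<rparr>)"
    unfolding T_def transport_def
    by (rule hom_imp_img_group)
  then show ?thesis
    by (simp add: T_def transport_def)
qed

sublocale T: group T
  by (rule group_T)

lemma inv_h: "x \<in> carrier G \<Longrightarrow> inv\<^bsub>T\<^esub> (h x) = h (inv x)"
  by (rule T.inv_equality) (simp_all add: T_simps)

lemma pow_h: "x \<in> carrier G \<Longrightarrow> h x [^]\<^bsub>T\<^esub> (n::nat) = h (x [^] n)"
  by (induction n) (simp_all add: T_simps)

lemma torsion_T: "torsion_group G \<Longrightarrow> torsion_group T"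
  unfolding torsion_group_def by (auto simp: T_simps pow_h) metis

lemma word_eval_h: "word_eval T (map h xs) = h (word_eval G xs)"
  by (induction xs) (simp_all add: T_simps)

lemma ball_h:
  assumes "S \<subseteq> carrier G"
  shows "ball T (h ` S) n = h ` ball G S n"
proof -
  define Z where "Z = S \<union> (\<lambda>s. inv s) ` S"
  have "(\<lambda>s. inv\<^bsub>T\<^esub> s) ` h ` S = h ` (\<lambda>s. inv s) ` S"
    unfolding image_image by (rule image_cong) (use assms inv_h in auto)
  then have sym: "h ` S \<union> (\<lambda>s. inv\<^bsub>T\<^esub> s) ` h ` S = h ` Z"
    by (simp only: Z_def image_Un)
  have "{ys. set ys \<subseteq> h ` Z \<and> length ys \<le> n} = map h ` {xs. set xs \<subseteq> Z \<and> length xs \<le> n}"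
  proof (intro equalityI subsetI)
    fix ys assume ys: "ys \<in> {ys. set ys \<subseteq> h ` Z \<and> length ys \<le> n}"
    then have "map (\<lambda>y. h (h' y)) ys = ys"
      by (intro map_idI) (auto simp: left_inverse)
    then have "ys = map h (map h' ys)"
      by (simp add: o_def)
    moreover have "map h' ys \<in> {xs. set xs \<subseteq> Z \<and> length xs \<le> n}"
      using ys by (auto simp: left_inverse)
    ultimately show "ys \<in> map h ` {xs. set xs \<subseteq> Z \<and> length xs \<le> n}"
      by (rule image_eqI)
  next
    fix ys assume "ys \<in> map h ` {xs. set xs \<subseteq> Z \<and> length xs \<le> n}"
    then obtain xs where "ys = map h xs" "set xs \<subseteq> Z" "length xs \<le> n"
      by blast
    then show "ys \<in> {ys. set ys \<subseteq> h ` Z \<and> length ys \<le> n}"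
      using image_mono[of "set xs" Z h] by simp
  qed
  then have "word_eval T ` {ys. set ys \<subseteq> h ` Z \<and> length ys \<le> n}
      = h ` word_eval G ` {xs. set xs \<subseteq> Z \<and> length xs \<le> n}"
    by (simp only: image_image word_eval_h)
  then show ?thesis
    unfolding ball_def sym Z_def[symmetric] by (simp only: setcompr_eq_image)
qed

lemma gen_group_T:
  assumes "gen_group G S"
  shows "gen_group T (h ` S)"
proof -
  interpret S: gen_group G S by fact
  interpret TS: gen_set T "h ` S"
    by unfold_locales (use S.finite_S S.S_carrier in \<open>auto simp: T_simps\<close>)
  have "carrier T = (\<Union>n. ball T (h ` S) n)"
    unfolding T_simps S.carrier_eq_Union_ball ball_h[OF S.S_carrier] by (rule image_UN)
  also have "\<dots> \<subseteq> generate T (h ` S)"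
    by (rule UN_least) (rule TS.ball_generate)
  finally have "generate T (h ` S) = carrier T"
    using T.generate_incl[OF TS.S_carrier] by (intro equalityI)
  then show ?thesis
    by unfold_locales
qed

lemma card_ball_h: "S \<subseteq> carrier G \<Longrightarrow> card (ball T (h ` S) n) = card (ball G S n)"
  by (simp only: ball_h card_image[OF inj_on_subset[OF inj_h subset_UNIV]])

lemma upper_exp_T: "S \<subseteq> carrier G \<Longrightarrow> upper_exp G S b \<Longrightarrow> upper_exp T (h ` S) b"
  by (simp add: upper_exp_def card_ball_h)

lemma lower_exp_T: "S \<subseteq> carrier G \<Longrightarrow> lower_exp G S b \<Longrightarrow> lower_exp T (h ` S) b"
  by (simp add: lower_exp_def card_ball_h)

end

subsection \<open>The groups \<open>K\<^sub>k\<close>\<close>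

text \<open>For exponent 0 both bounds concern constants: the sums are at most the order of the
  group, and balls of positive radius have at least \<open>exp (ln 2)\<close> elements.\<close>

lemma (in group) finite_group_exponents:
  assumes "finite (carrier G)" "2 \<le> card (carrier G)"
  shows "gen_group G (carrier G)" "gen_group.upper_sum G (carrier G) 0" "lower_exp G (carrier G) 0"
    "torsion_group G"
proof -
  show gen: "gen_group G (carrier G)"
    using assms(1) generate_incl[of "carrier G"] generate.incl[of _ "carrier G" G]
    by unfold_locales auto
  interpret gen_group G "carrier G"
    by (rule gen)
  define N where "N = card (carrier G)"
  have N: "2 \<le> N"
    using assms(2) by (simp add: N_def)
  have "(\<Sum>g\<in>ball G (carrier G) n. exp (- (ln N * L powr (0 - 1)) * real (len g))) \<le> exp (ln N * L powr 0)"
    if L: "L \<ge> 1" for L n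
  proof -
    have "(\<Sum>g\<in>ball G (carrier G) n. exp (- (ln N * L powr (0 - 1)) * real (len g)))
        \<le> (\<Sum>g\<in>ball G (carrier G) n. 1)"
      using N by (intro sum_mono) simp
    also have "\<dots> \<le> real N"
      using card_mono[OF assms(1) ball_carrier] by (simp add: N_def)
    also have "\<dots> = exp (ln N * L powr 0)"
      using L N by simp
    finally show ?thesis .
  qed
  then show "upper_sum 0"
    unfolding upper_sum_def using N by (intro exI[of _ "ln (real N)"]) simp
  have "exp (ln 2 * real n powr 0) \<le> real (card (ball G (carrier G) (1 * n)))" if n: "n \<ge> 1" for n
  proof -
    have "carrier G \<subseteq> ball G (carrier G) 1"
      using sym_in_ball by blast
    also have "\<dots> \<subseteq> ball G (carrier G) n"
      using n by (rule ball_mono)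
    finally have "N \<le> card (ball G (carrier G) n)"
      unfolding N_def by (rule card_mono[OF finite_ball])
    then show ?thesis
      using N n by simp
  qed
  then show "lower_exp G (carrier G) 0"
    unfolding lower_exp_def by (intro exI[of _ "ln 2"] conjI exI[of _ 1]) simp_all
  show "torsion_group G"
    unfolding torsion_group_def
    using assms(1) pow_order_eq_1 order_gt_0_iff_finite by blast
qed

definition Kexp :: "nat \<Rightarrow> real" where
  "Kexp k = 1 - (1 - alpha) ^ k"

text \<open>The affine map \<open>b -> alpha + (1 - alpha) * b\<close> has fixed point 1 and factor
  \<open>1 - alpha\<close>, so \<open>Kexp\<close> is its orbit of 0.\<close>

lemma Kexp_0 [simp]: "Kexp 0 = 0"
  and Kexp_Suc: "Kexp (Suc k) = alpha + (1 - alpha) * Kexp k"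
  by (simp_all add: Kexp_def algebra_simps)

lemma Kexp_nonneg: "0 \<le> Kexp k" and Kexp_le_1: "Kexp k \<le> 1"
  and Kexp_pos: "k \<ge> 1 \<Longrightarrow> 0 < Kexp k"
proof -
  show "0 \<le> Kexp k" "Kexp k \<le> 1"
    using alpha_pos alpha_less_1 power_le_one[of "1 - alpha" k] by (simp_all add: Kexp_def)
  show "0 < Kexp k" if "k \<ge> 1"
    using alpha_pos alpha_less_1 that power_less_one_iff[of "1 - alpha" k] by (simp add: Kexp_def)
qed

lemma transported_step:
  assumes A: "gen_group A S" "torsion_group A" "gen_group.upper_sum A S b" "lower_exp A S b" "0 \<le> b"
  defines "K \<equiv> transport (\<lambda>(f, g). KW f g) (\<lambda>x. (kf x, kg x)) (wreath A)"
  shows "group K \<and> torsion_group K \<and> (\<exists>S'. gen_group K S'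
    \<and> upper_exp K S' (alpha + (1 - alpha) * b) \<and> lower_exp K S' (alpha + (1 - alpha) * b))"
proof -
  interpret gen_group A S by (rule A(1))
  interpret wreath_gen A S by unfold_locales
  interpret K: transported W "\<lambda>(f, g). KW f g" "\<lambda>x. (kf x, kg x)"
    by unfold_locales auto
  have K: "K = K.T"
    unfolding K_def K.T_def unfolding W_def ..
  show ?thesis
    unfolding K
    using K.group_T K.torsion_T[OF torsion_W[OF A(2)]] K.gen_group_T[OF WS.gen_group_axioms]
      K.upper_exp_T[OF SW_carrier upper_exp_W[OF A(3,5)]]
      K.lower_exp_T[OF SW_carrier lower_exp_W[OF A(4,5)]]
    by blast
qed

lemma Kgrp_0: "group (Kgrp 0) \<and> finite (carrier (Kgrp 0)) \<and> card (carrier (Kgrp 0)) = 2"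
proof -
  interpret Z: group "integer_mod_group 2"
    by simp
  interpret K: transported "integer_mod_group 2" KZ kz
    by unfold_locales simp
  have "carrier (Kgrp 0) = KZ ` {0..<2}"
    using K.T_simps(1) by (simp add: K.T_def carrier_integer_mod_group)
  moreover have "card (KZ ` {0..<2}) = 2"
    by (subst card_image) (simp_all add: inj_on_def)
  ultimately show ?thesis
    using K.group_T by (simp add: K.T_def)
qed

text \<open>\<open>upper_sum\<close> is what the next wreath step consumes. At \<open>k = 0\<close>
  it comes from finiteness; afterwards the step yields \<open>upper_exp\<close> with a positive
  exponent, from which \<open>upper_sumI\<close> recovers it.\<close>

lemma Kgrp_invariant:
  "group (Kgrp k) \<and> torsion_group (Kgrp k) \<and> (\<exists>S. gen_group (Kgrp k) S
    \<and> gen_group.upper_sum (Kgrp k) S (Kexp k) \<and> lower_exp (Kgrp k) S (Kexp k)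
    \<and> (k \<ge> 1 \<longrightarrow> upper_exp (Kgrp k) S (Kexp k)))"
proof (induction k)
  case 0
  interpret K: group "Kgrp 0"
    using Kgrp_0 by (elim conjE)
  show ?case
    using K.is_group K.finite_group_exponents Kgrp_0 by (simp del: Kgrp.simps) blast
next
  case (Suc k)
  then obtain S where S: "gen_group (Kgrp k) S" "torsion_group (Kgrp k)"
    "gen_group.upper_sum (Kgrp k) S (Kexp k)" "lower_exp (Kgrp k) S (Kexp k)"
    by (elim conjE exE)
  obtain S' where S': "group (Kgrp (Suc k))" "torsion_group (Kgrp (Suc k))" "gen_group (Kgrp (Suc k)) S'"
    "upper_exp (Kgrp (Suc k)) S' (Kexp (Suc k))" "lower_exp (Kgrp (Suc k)) S' (Kexp (Suc k))"
    using transported_step[OF S Kexp_nonneg] unfolding Kgrp.simps Kexp_Suc by (elim conjE exE)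
  have "gen_group.upper_sum (Kgrp (Suc k)) S' (Kexp (Suc k))"
    by (rule gen_group.upper_sumI[OF S'(3,4) Kexp_pos Kexp_le_1]) simp
  then show ?case
    using S' by blast
qed

theorem theorem5p2:
  shows "\<forall>k::nat. group (Kgrp k) \<and> fin_gen (Kgrp k) \<and> torsion_group (Kgrp k)
     \<and> (k \<ge> 1 \<longrightarrow> infinite (carrier (Kgrp k)))
     \<and> (k \<ge> 1 \<longrightarrow> (\<forall>S. finite S \<and> S \<subseteq> carrier (Kgrp k) \<and> generate (Kgrp k) S = carrier (Kgrp k)
            \<longrightarrow> gequiv (growth (Kgrp k) S)
                       (\<lambda>n. exp (real n powr (1 - (1 - alpha) ^ k)))))"
proof (intro allI conjI impI)
  fix k
  obtain T where T: "group (Kgrp k)" "torsion_group (Kgrp k)" "gen_group (Kgrp k) T"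
    "lower_exp (Kgrp k) T (Kexp k)" "k \<ge> 1 \<Longrightarrow> upper_exp (Kgrp k) T (Kexp k)"
    using Kgrp_invariant[of k] by (elim conjE exE) simp
  interpret T: gen_group "Kgrp k" T
    by (rule T(3))
  show "group (Kgrp k)" "torsion_group (Kgrp k)"
    by (rule T)+
  show "fin_gen (Kgrp k)"
    unfolding fin_gen_def using T.finite_S T.S_carrier T.generate_S by blast
  assume k: "k \<ge> 1"
  show "infinite (carrier (Kgrp k))"
    by (rule infinite_carrier[OF T(3,4) Kexp_pos[OF k]])
  fix S assume S: "finite S \<and> S \<subseteq> carrier (Kgrp k) \<and> generate (Kgrp k) S = carrier (Kgrp k)"
  have "gen_group (Kgrp k) S"
    by unfold_locales (use S in simp_all)
  from gequiv_exp[OF T(3) this T(5)[OF k] T(4) Kexp_pos[OF k]]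
  show "gequiv (growth (Kgrp k) S) (\<lambda>n. exp (real n powr (1 - (1 - alpha) ^ k)))"
    by (simp only: Kexp_def)
qed

end
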